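(* Let $\alpha,\beta\in\mathbb{K}^*$ be roots of unity such that $\alpha\neq\beta$ and $\alpha\neq\beta^{-1}$. Then the PI degree of $M_2(\alpha,\beta)$ is $$\operatorname{PI-deg} M_2(\alpha,\beta)=\begin{cases}\operatorname{ord}(\alpha\beta)\operatorname{ord}(\alpha\beta^{-1}), & \text{if } \operatorname{ord}(\beta)\mid \operatorname{ord}(\alpha\beta)\operatorname{ord}(\alpha\beta^{-1}),\\ 2\operatorname{ord}(\alpha\beta)\operatorname{ord}(\alpha\beta^{-1}), & \text{otherwise.}\end{cases}$$
   Context: $\mathbb{K}$ is an algebraically closed field of arbitrary characteristic and $\mathbb{K}^*=\mathbb{K}\setminus\{0\}$. For a root of unity $\xi\in\mathbb{K}^*$, $\operatorname{ord}(\xi)$ is its order in the group $\mathbb{K}^*$. For $\alpha,\beta\in\mathbb{K}^*$, the two-parameter quantum matrix algebra $M_2(\alpha,\beta)$ is the associative unital $\mathbb{K}$-algebra generated by $X_{11},X_{12},X_{21},X_{22}$ subject to the relations $X_{12}X_{11}=\alpha X_{11}X_{12}$, $X_{22}X_{21}=\alpha X_{21}X_{22}$, $X_{21}X_{11}=\beta X_{11}X_{21}$, $X_{22}X_{12}=\beta X_{12}X_{22}$, $X_{21}X_{12}=\beta\alpha^{-1}X_{12}X_{21}$, $X_{22}X_{11}-X_{11}X_{22}=(\beta-\alpha^{-1})X_{12}X_{21}$. When $\alpha,\beta$ are roots of unity, this algebra is a prime affine polynomial identity (PI) algebra. The PI degree of a prime PI algebra $A$, denoted $\operatorname{PI-deg}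 A$, is half of the minimal degree of a (monic multilinear) polynomial identity satisfied by $A$. *)

theory Defs
  imports
    "HOL-Algebra.Algebraic_Closure_Type"
    "HOL-Algebra.QuotRing"
    "HOL-Algebra.Module"
    "HOL-Algebra.Multiplicative_Group"
    "HOL-Library.Poly_Mapping"
begin

section \<open>Free associative algebras\<close>

text \<open>
  The free monoid, written additively because multiplication of \<^typ>\<open>'m \<Rightarrow>\<^sub>0 'k\<close>
  is convolution along \<open>+\<close> on \<open>'m\<close>. Thus \<open>'x word \<Rightarrow>\<^sub>0 'k\<close>
  is the free unital associative \<open>'k\<close>-algebra on \<open>'x\<close>.
\<close>

datatype 'x word = Word (letters: "'x list")

instantiation word :: (type) monoid_add
begin

definition zero_word :: "'x word" where
  "zero_word = Word []"

definition plus_word :: "'x word \<Rightarrow> 'x word \<Rightarrow> 'x word" where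
  "plus_word v w = Word (letters v @ letters w)"

instance
  by standard (simp_all add: zero_word_def plus_word_def)

end

type_synonym ('x, 'k) free_alg = "'x word \<Rightarrow>\<^sub>0 'k"

definition free_var :: "'x \<Rightarrow> ('x, 'k::field) free_alg" where
  "free_var x = Poly_Mapping.single (Word [x]) 1"

definition free_const :: "'k \<Rightarrow> ('x, 'k::field) free_alg" where
  "free_const c = Poly_Mapping.single 0 c"

text \<open>
  Unital associative algebras over the field \<open>'k\<close> are given by records of type
  \<^typ>\<open>('k, 'a) module\<close>, that is, a ring together with scalar multiplication by \<open>'k\<close>.
  (The locale \<^locale>\<open>algebra\<close> covers commutative algebras only.)
\<close>

definition free_algebra :: "('k::field, ('x, 'k) free_alg) module" where
  "free_algebra =
     ring.extend ring_of_type_algebra (module.fields (\<lambda>c f. free_const c * f))"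

definition quot_algebra :: "('k, 'a) module \<Rightarrow> 'a set \<Rightarrow> ('k, 'a set) module" where
  "quot_algebra A I =
     ring.extend (A Quot I) (module.fields (\<lambda>c C. \<Union>x\<in>C. I +>\<^bsub>A\<^esub> (c \<odot>\<^bsub>A\<^esub> x)))"


section \<open>The two-parameter quantum matrix algebra\<close>

datatype mat_gen = X11 | X12 | X21 | X22

definition qmat_relators :: "'k::field \<Rightarrow> 'k \<Rightarrow> (mat_gen, 'k) free_alg set" where
  "qmat_relators \<alpha> \<beta> =
     (let x11 = free_var X11; x12 = free_var X12; x21 = free_var X21; x22 = free_var X22
      in {x12 * x11 - free_const \<alpha> * x11 * x12,
          x22 * x21 - free_const \<alpha> * x21 * x22,
          x21 * x11 - free_const \<beta> * x11 * x21,
          x22 * x12 - free_const \<beta> * x12 * x22,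
          x21 * x12 - free_const (\<beta> * inverse \<alpha>) * x12 * x21,
          (x22 * x11 - x11 * x22) - free_const (\<beta> - inverse \<alpha>) * x12 * x21})"

text \<open>\<^const>\<open>genideal\<close> is the two-sided ideal generated by a set.\<close>

definition qmat_algebra :: "'k::field \<Rightarrow> 'k \<Rightarrow> ('k, (mat_gen, 'k) free_alg set) module" where
  "qmat_algebra \<alpha> \<beta> = quot_algebra free_algebra (Idl\<^bsub>free_algebra\<^esub> (qmat_relators \<alpha> \<beta>))"


section \<open>Polynomial identities and the PI degree\<close>

text \<open>Noncommutative polynomials in countably many variables, indexed by \<^typ>\<open>nat\<close>.\<close>

type_synonym 'k nc_poly = "(nat, 'k) free_alg"

definition nc_degree :: "'k::field nc_poly \<Rightarrow> nat" where
  "nc_degree f = Max ((\<lambda>w. length (letters w)) ` Poly_Mapping.keys f)"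

text \<open>Monic: some word of maximal length occurs with coefficient \<open>1\<close>; in particular \<open>f \<noteq> 0\<close>.\<close>

definition nc_monic :: "'k::field nc_poly \<Rightarrow> bool" where
  "nc_monic f \<longleftrightarrow>
     (\<exists>w \<in> Poly_Mapping.keys f.
        length (letters w) = nc_degree f \<and> Poly_Mapping.lookup f w = 1)"

text \<open>Multilinear: each variable of some set \<open>V\<close> occurs exactly once in every monomial.\<close>

definition nc_multilinear :: "'k::field nc_poly \<Rightarrow> bool" where
  "nc_multilinear f \<longleftrightarrow>
     (\<exists>V. \<forall>w \<in> Poly_Mapping.keys f. distinct (letters w) \<and> set (letters w) = V)"

definition word_eval :: "('k, 'a) module \<Rightarrow> ('x \<Rightarrow> 'a) \<Rightarrow> 'x word \<Rightarrow> 'a" where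
  "word_eval A a w = foldr (\<lambda>x r. a x \<otimes>\<^bsub>A\<^esub> r) (letters w) \<one>\<^bsub>A\<^esub>"

definition nc_eval :: "('k::field, 'a) module \<Rightarrow> (nat \<Rightarrow> 'a) \<Rightarrow> 'k nc_poly \<Rightarrow> 'a" where
  "nc_eval A a f =
     (\<Oplus>\<^bsub>A\<^esub>w \<in> Poly_Mapping.keys f. Poly_Mapping.lookup f w \<odot>\<^bsub>A\<^esub> word_eval A a w)"

definition poly_identity :: "('k::field, 'a) module \<Rightarrow> 'k nc_poly \<Rightarrow> bool" where
  "poly_identity A f \<longleftrightarrow> (\<forall>a. (\<forall>i. a i \<in> carrier A) \<longrightarrow> nc_eval A a f = \<zero>\<^bsub>A\<^esub>)"

definition PI_degrees :: "('k::field, 'a) module \<Rightarrow> nat set" where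
  "PI_degrees A =
     {nc_degree f | f. nc_monic f \<and> nc_multilinear f \<and> poly_identity A f}"

text \<open>
  Rational-valued, so that halving does not truncate. The notion is meant for prime PI
  algebras; the value \<open>0\<close> in the absence of an identity is a dummy, which no PI algebra
  with \<open>1 \<noteq> 0\<close> attains.
\<close>

definition PI_deg :: "('k::field, 'a) module \<Rightarrow> rat" where
  "PI_deg A = (if PI_degrees A = {} then 0 else of_nat (LEAST d. d \<in> PI_degrees A) / 2)"


section \<open>Roots of unity\<close>

definition root_of_unity :: "'k::field \<Rightarrow> bool" where
  "root_of_unity \<xi> \<longleftrightarrow> (\<exists>n>0. \<xi> ^ n = 1)"

definition unit_ord :: "'k::field \<Rightarrow> nat" where
  "unit_ord \<xi> = group.ord (mult_of ring_of_type_algebra) \<xi>"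

end

theory Submission
  imports Defs "Jordan_Normal_Form.Determinant" "HOL-Computational_Algebra.Formal_Power_Series"
begin

text \<open>
  The algebra acts faithfully on functions of \<open>(x, y, p, q)\<close>: the element \<open>X11\<close> and the quantum
  determinant are diagonal, and \<open>X12\<close>, \<open>X21\<close> move \<open>(x, y)\<close> by \<open>(\<alpha>, \<beta>\<inverse>)\<close> and \<open>(\<beta>, \<alpha>\<inverse>)\<close>. Let \<open>N\<close> be
  the order of the group generated by these two pairs. The action decomposes over orbits of size at
  most \<open>N\<close>, so the algebra embeds into a product of matrix algebras of size at most \<open>N\<close>, and the
  standard polynomial of degree \<open>2 N\<close> is an identity by the Amitsur--Levitzki theorem. On the orbit
  of \<open>(1, 1)\<close> the joint eigenvalues are distinct and permuted transitively, so that all of the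
  \<open>N \<times> N\<close> matrices are attained and no identity has smaller degree. Counting the group gives the
  formula.
\<close>

section \<open>The Amitsur--Levitzki theorem\<close>

text \<open>The characteristic of the field is arbitrary, whereas Rosset's proof of the
  Amitsur--Levitzki theorem deduces nilpotency from vanishing traces and has to divide by integers.
  It is therefore run over the integers only; multilinearity of the standard polynomial and the
  integral entries of matrix units carry the result to every commutative ring. The representation
  originates in the fact that \<open>X11\<close> and the quantum determinant commute with each
  other, and with \<open>X12\<close> and \<open>X21\<close> up to scalars. So \<open>X12\<close> and
  \<open>X21\<close> move the joint eigenvalues multiplicatively, and \<open>X22\<close> is
  recovered from the determinant. Acting on functions on the whole space of eigenvalues, with
  \<open>p\<close> and \<open>q\<close> as further coordinates, avoids inverting \<open>X11\<close>
  or passing to a function field. The price is that degenerate points with small orbits occur and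
  have to satisfy the same identity. Faithfulness becomes a comparison of coefficients of polynomial
  functions over an infinite field.\<close>

lemma derivation_prod:
  fixes d :: "'a::comm_ring_1 \<Rightarrow> 'a"
  assumes "\<And>x y. d (x * y) = x * d y + d x * y" and "finite S"
  shows "d (prod f S) = (\<Sum>i\<in>S. d (f i) * prod f (S - {i}))"
  using assms(2)
proof (induction S rule: finite_induct)
  case empty
  have "d (1 * 1) = 1 * d 1 + d 1 * 1" by (rule assms(1))
  then show ?case by simp
next
  case (insert s S)
  have *: "d (f i) * prod f (insert s S - {i}) = f s * (d (f i) * prod f (S - {i}))" if "i \<in> S" for i
  proof -
    have "insert s S - {i} = insert s (S - {i})" using that insert.hyps by auto
    then show ?thesis using insert.hyps by (simp add: ac_simps)
  qed
  have "(\<Sum>i\<in>S. d (f i) * prod f (insert s S - {i})) = f s * (\<Sum>i\<in>S. d (f i) * prod f (S - {i}))"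
    unfolding sum_distrib_left by (intro sum.cong refl *)
  with insert show ?case by (simp add: assms(1) Diff_insert_absorb algebra_simps)
qed

text \<open>Jacobi's formula for an abstract derivation. By the Leibniz rule the rows are
  differentiated one at a time; expanding \<open>B i\<close> along its differentiated row
  \<open>i\<close> produces cofactors of \<open>A\<close>, since the other rows are
  untouched.\<close>

lemma derivation_det:
  fixes d :: "'a::comm_ring_1 \<Rightarrow> 'a"
  assumes add: "\<And>x y. d (x + y) = d x + d y"
    and mult: "\<And>x y. d (x * y) = x * d y + d x * y"
    and A: "A \<in> carrier_mat n n"
  shows "d (det A) = (\<Sum>i<n. \<Sum>j<n. d (A $$ (i, j)) * cofactor A i j)"
proof -
  define B where "B i = mat n n (\<lambda>(k, j). if k = i then d (A $$ (i, j)) else A $$ (k, j))" for i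
  have B: "B i \<in> carrier_mat n n" for i by (simp add: B_def)
  have d0: "d 0 = 0" using add[of 0 0] by simp
  have dneg: "d (- x) = - d x" for x using add[of x "- x"] d0 by (simp add: eq_neg_iff_add_eq_0 add.commute)
  have dsum: "d (sum f S) = (\<Sum>x\<in>S. d (f x))" if "finite S" for f and S :: "(nat \<Rightarrow> nat) set"
    using that by (induction S rule: finite_induct) (simp_all add: d0 add)
  have dsign: "d (signof p * x) = signof p * d x" for p x
    by (cases p rule: sign_cases) (simp_all add: dneg)
  have perm: "(\<Prod>k\<in>{0..<n}. B i $$ (k, p k)) = d (A $$ (i, p i)) * (\<Prod>k\<in>{0..<n} - {i}. A $$ (k, p k))"
    if "p permutes {0..<n}" "i \<in> {0..<n}" for p i
  proof -
    have lt: "k < n \<Longrightarrow> p k < n" for k using permutes_in_image[OF that(1), of k] by simp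
    have "(\<Prod>k\<in>{0..<n}. B i $$ (k, p k)) = B i $$ (i, p i) * (\<Prod>k\<in>{0..<n} - {i}. B i $$ (k, p k))"
      using that(2) by (intro prod.remove) auto
    also have "(\<Prod>k\<in>{0..<n} - {i}. B i $$ (k, p k)) = (\<Prod>k\<in>{0..<n} - {i}. A $$ (k, p k))"
      by (intro prod.cong refl) (auto simp: B_def lt)
    also have "B i $$ (i, p i) = d (A $$ (i, p i))" using that(2) lt by (simp add: B_def)
    finally show ?thesis .
  qed
  have "d (det A) = (\<Sum>p | p permutes {0..<n}. signof p * (\<Sum>i\<in>{0..<n}. d (A $$ (i, p i)) * (\<Prod>k\<in>{0..<n} - {i}. A $$ (k, p k))))"
    unfolding det_def'[OF A] by (simp add: dsum finite_permutations dsign derivation_prod[of d, OF mult])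
  also have "\<dots> = (\<Sum>p | p permutes {0..<n}. \<Sum>i\<in>{0..<n}. signof p * (\<Prod>k\<in>{0..<n}. B i $$ (k, p k)))"
    by (intro sum.cong refl) (simp add: sum_distrib_left perm)
  also have "\<dots> = (\<Sum>i\<in>{0..<n}. det (B i))"
    unfolding det_def'[OF B] by (rule sum.swap)
  also have "\<dots> = (\<Sum>i\<in>{0..<n}. \<Sum>j<n. d (A $$ (i, j)) * cofactor A i j)"
  proof (intro sum.cong refl)
    fix i assume i: "i \<in> {0..<n}"
    have "mat_delete (B i) i j = mat_delete A i j" if "j < n" for j
      using A i that by (intro eq_matI) (auto simp: mat_delete_def B_def)
    with i show "det (B i) = (\<Sum>j<n. d (A $$ (i, j)) * cofactor A i j)"
      by (subst laplace_expansion_row[OF B]) (auto simp: cofactor_def B_def intro!: sum.cong)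
  qed
  finally show ?thesis by (simp add: atLeast0LessThan)
qed

lemma fps_prod_nth_eq_0:
  fixes f :: "'b \<Rightarrow> 'a::comm_ring_1 fps"
  assumes "finite S" and "\<And>s k. s \<in> S \<Longrightarrow> k > 1 \<Longrightarrow> f s $ k = 0" and "k > card S"
  shows "prod f S $ k = 0"
  using assms
proof (induction S arbitrary: k rule: finite_induct)
  case (insert s S)
  have "f s $ i * prod f S $ (k - i) = 0" if "i \<le> k" for i
  proof (cases "i > 1")
    case False
    with insert.hyps insert.prems(2) have "k - i > card S" by simp
    with insert show ?thesis by simp
  qed (use insert.prems in simp)
  then show ?case using insert.hyps by (simp add: fps_mult_nth)
qed simp

text \<open>This produces the nilpotency exponent \<open>n\<close>: up to sign, the entries of the
  adjugate of \<open>1 - x B\<close> are minors of size \<open>n - 1\<close> whose entries have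
  degree at most one, so their coefficient of \<open>x^n\<close> vanishes.\<close>

lemma fps_det_nth_eq_0:
  fixes C :: "'a::comm_ring_1 fps mat"
  assumes C: "C \<in> carrier_mat m m"
    and "\<And>i j k. i < m \<Longrightarrow> j < m \<Longrightarrow> k > 1 \<Longrightarrow> C $$ (i, j) $ k = 0" and "k > m"
  shows "det C $ k = 0"
proof -
  have *: "(\<Prod>i = 0..<m. C $$ (i, p i)) $ k = 0" if "p permutes {0..<m}" for p
  proof (rule fps_prod_nth_eq_0)
    fix i l :: nat assume "i \<in> {0..<m}" "l > 1"
    with permutes_in_image[OF that, of i] show "C $$ (i, p i) $ l = 0" by (intro assms) auto
  qed (use assms in auto)
  have "(signof p * (\<Prod>i = 0..<m. C $$ (i, p i))) $ k = 0" if "p permutes {0..<m}" for p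
    using *[OF that] by (cases p rule: sign_cases) simp_all
  then show ?thesis unfolding det_def'[OF C] by (simp add: fps_sum_nth)
qed

text \<open>
  Write \<open>p = det (1 - x B)\<close> over the power series ring. Jacobi's formula turns the adjugate
  identity into \<open>k p\<^sub>k = - tr (B N)\<close>, where \<open>N\<close> is the coefficient of \<open>x\<close> to the
  \<open>k - 1\<close> in the adjugate. So \<open>p = 1\<close>, the adjugate is the geometric series of \<open>B\<close>,
  and it is a polynomial of degree less than \<open>n\<close>.
\<close>

lemma nilpotent_of_trace_power_eq_0:
  fixes B :: "'a::comm_ring_1 mat"
  assumes B: "B \<in> carrier_mat n n"
    and torsion_free: "\<And>(k::nat) (x::'a). k > 0 \<Longrightarrow> of_nat k * x = 0 \<Longrightarrow> x = 0"
    and trace: "\<And>k. k > 0 \<Longrightarrow> (\<Sum>i<n. (B ^\<^sub>m k) $$ (i, i)) = 0"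
  shows "B ^\<^sub>m n = 0\<^sub>m n n"
proof -
  define A where "A = mat n n (\<lambda>(i, j). (if i = j then 1 else 0) - fps_X * fps_const (B $$ (i, j)))"
  have A: "A \<in> carrier_mat n n" by (simp add: A_def)
  define p where "p = det A"
  define N where "N k = mat n n (\<lambda>(i, j). adj_mat A $$ (i, j) $ k)" for k
  have N: "N k \<in> carrier_mat n n" for k by (simp add: N_def)
  have adj: "adj_mat A \<in> carrier_mat n n" "adj_mat A * A = p \<cdot>\<^sub>m 1\<^sub>m n"
    using adj_mat[OF A] by (simp_all add: p_def)
  have adj_ij: "adj_mat A $$ (i, j) = cofactor A j i" if "i < n" "j < n" for i j
    using that A by (simp add: adj_mat_def)
  \<comment> \<open>Entry \<open>(i, j)\<close> of \<open>adj A * A = p\<close> with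
    \<open>A = 1 - x B\<close>, solved for the adjugate. Comparing coefficients turns it into the
    recursion for \<open>N\<close>.\<close>
  have rec: "adj_mat A $$ (i, j) = fps_X * (\<Sum>l<n. adj_mat A $$ (i, l) * fps_const (B $$ (l, j))) + (if i = j then p else 0)"
    if "i < n" "j < n" for i j
  proof -
    have "(if i = j then p else 0) = (adj_mat A * A) $$ (i, j)"
      using that by (simp add: adj(2))
    also have "\<dots> = (\<Sum>l<n. adj_mat A $$ (i, l) * A $$ (l, j))"
      using A adj(1) that by (simp add: scalar_prod_def atLeast0LessThan)
    also have "\<dots> = (\<Sum>l<n. (if l = j then adj_mat A $$ (i, l) else 0) - fps_X * (adj_mat A $$ (i, l) * fps_const (B $$ (l, j))))"
      using that by (intro sum.cong refl) (auto simp: A_def algebra_simps)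
    also have "\<dots> = adj_mat A $$ (i, j) - fps_X * (\<Sum>l<n. adj_mat A $$ (i, l) * fps_const (B $$ (l, j)))"
      using that by (simp add: sum_subtractf sum_distrib_left)
    finally show ?thesis by simp
  qed
  have N0: "N 0 = p $ 0 \<cdot>\<^sub>m 1\<^sub>m n"
    by (intro eq_matI) (auto simp: N_def rec)
  have N_Suc: "N (Suc k) = N k * B + p $ Suc k \<cdot>\<^sub>m 1\<^sub>m n" for k
  proof (intro eq_matI)
    fix i j assume "i < dim_row (N k * B + p $ Suc k \<cdot>\<^sub>m 1\<^sub>m n)" "j < dim_col (N k * B + p $ Suc k \<cdot>\<^sub>m 1\<^sub>m n)"
    with B have ij: "i < n" "j < n" by simp_all
    have "adj_mat A $$ (i, j) $ Suc k = (\<Sum>l<n. adj_mat A $$ (i, l) $ k * B $$ (l, j)) + (if i = j then p $ Suc k else 0)"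
      by (subst rec[OF ij]) (simp add: fps_sum_nth)
    with ij B show "N (Suc k) $$ (i, j) = (N k * B + p $ Suc k \<cdot>\<^sub>m 1\<^sub>m n) $$ (i, j)"
      by (simp add: N_def scalar_prod_def atLeast0LessThan)
  qed (use B N[of "Suc k"] in simp_all)
  interpret coeff0: comm_ring_hom "\<lambda>f::'a fps. f $ 0"
    by unfold_locales simp_all
  have "map_mat (\<lambda>f. f $ 0) A = 1\<^sub>m n"
    by (intro eq_matI) (auto simp: A_def)
  with coeff0.hom_det[of A] have p0: "p $ 0 = 1" by (simp add: p_def)
  have p_Suc: "of_nat (Suc k) * p $ Suc k = - (\<Sum>i<n. (N k * B) $$ (i, i))" for k
  proof -
    have "fps_deriv p = (\<Sum>i<n. \<Sum>j<n. fps_deriv (A $$ (i, j)) * cofactor A i j)"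
      unfolding p_def by (rule derivation_det[OF _ _ A]) simp_all
    also have "\<dots> = (\<Sum>i<n. \<Sum>j<n. - (fps_const (B $$ (i, j)) * adj_mat A $$ (j, i)))"
    proof (intro sum.cong refl)
      fix i j assume "i \<in> {..<n}" "j \<in> {..<n}"
      then have ij: "i < n" "j < n" by simp_all
      then have "fps_deriv (A $$ (i, j)) = - fps_const (B $$ (i, j))"
        by (simp add: A_def)
      then show "fps_deriv (A $$ (i, j)) * cofactor A i j = - (fps_const (B $$ (i, j)) * adj_mat A $$ (j, i))"
        by (simp only: adj_ij[OF ij(2,1)] mult_minus_left)
    qed
    finally have "fps_deriv p $ k = - (\<Sum>i<n. \<Sum>j<n. B $$ (i, j) * adj_mat A $$ (j, i) $ k)"
      by (simp add: fps_sum_nth sum_negf)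
    also have "(\<Sum>i<n. \<Sum>j<n. B $$ (i, j) * adj_mat A $$ (j, i) $ k) = (\<Sum>j<n. \<Sum>i<n. adj_mat A $$ (j, i) $ k * B $$ (i, j))"
      by (subst sum.swap) (simp add: mult.commute)
    also have "\<dots> = (\<Sum>i<n. (N k * B) $$ (i, i))"
      using B by (simp add: N_def scalar_prod_def atLeast0LessThan)
    finally show ?thesis by simp
  qed
  have pow: "N k = B ^\<^sub>m k" for k
  proof (induction k)
    case 0
    show ?case using B by (intro eq_matI) (auto simp: N0 p0)
  next
    case (Suc k)
    have "of_nat (Suc k) * p $ Suc k = 0"
      using trace[of "Suc k"] by (simp only: p_Suc Suc) simp
    then have "p $ Suc k = 0" by (rule torsion_free[rotated]) simp
    moreover have "B ^\<^sub>m k * B \<in> carrier_mat n n" using mult_carrier_mat[OF N B, of k] by (simp only: Suc)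
    moreover have "M + 0 \<cdot>\<^sub>m 1\<^sub>m n = M" if "M \<in> carrier_mat n n" for M :: "'a mat"
      using that by (intro eq_matI) auto
    ultimately show ?case by (simp add: N_Suc Suc)
  qed
  have "N n = 0\<^sub>m n n"
  proof (intro eq_matI)
    fix i j assume "i < dim_row (0\<^sub>m n n :: 'a mat)" "j < dim_col (0\<^sub>m n n :: 'a mat)"
    then have ij: "i < n" "j < n" by simp_all
    have "det (mat_delete A j i) $ n = 0"
    proof (rule fps_det_nth_eq_0)
      show "mat_delete A j i \<in> carrier_mat (n - 1) (n - 1)" using A by (rule mat_delete_carrier)
      show "mat_delete A j i $$ (r, s) $ k = 0" if "r < n - 1" "s < n - 1" "k > 1" for r s k
        using that A by (auto simp: mat_delete_def A_def)
    qed (use ij in simp)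
    then have "cofactor A j i $ n = 0"
      by (cases "even (j + i)") (simp_all add: cofactor_def)
    with ij show "N n $$ (i, j) = 0\<^sub>m n n $$ (i, j)" by (simp add: N_def adj_ij)
  qed (simp_all add: N_def)
  then show ?thesis by (simp add: pow)
qed

section \<open>Shuffle signs and the even exterior algebra\<close>

text \<open>For disjoint \<open>S\<close> and \<open>T\<close>, the sign in
  \<open>e_S e_T = \<plusminus> e_(S \<union> T)\<close>: the parity of the number of exchanges that
  sort \<open>S\<close> followed by \<open>T\<close>.\<close>

definition shuffle_sign :: "nat set \<Rightarrow> nat set \<Rightarrow> int" where
  "shuffle_sign S T = (-1) ^ card {(s, t). s \<in> S \<and> t \<in> T \<and> t < s}"

lemma finite_inversions: "finite S \<Longrightarrow> finite T \<Longrightarrow> finite {(s, t). s \<in> S \<and> t \<in> T \<and> (t::nat) < s}"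
  by (rule finite_subset[of _ "S \<times> T"]) auto

lemma shuffle_sign_empty [simp]: "shuffle_sign {} T = 1" "shuffle_sign S {} = 1"
  by (simp_all add: shuffle_sign_def)

lemma shuffle_sign_union_left:
  assumes "finite S" "finite S'" "finite T" "S \<inter> S' = {}"
  shows "shuffle_sign (S \<union> S') T = shuffle_sign S T * shuffle_sign S' T"
proof -
  have "{(s, t). s \<in> S \<union> S' \<and> t \<in> T \<and> t < s}
      = {(s, t). s \<in> S \<and> t \<in> T \<and> t < s} \<union> {(s, t). s \<in> S' \<and> t \<in> T \<and> t < s}" by auto
  with assms show ?thesis
    unfolding shuffle_sign_def
    by (subst power_add[symmetric], subst card_Un_disjoint[symmetric]) (auto simp: finite_inversions)
qed

lemma shuffle_sign_union_right:
  assumes "finite S" "finite T" "finite T'" "T \<inter> T' = {}"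
  shows "shuffle_sign S (T \<union> T') = shuffle_sign S T * shuffle_sign S T'"
proof -
  have "{(s, t). s \<in> S \<and> t \<in> T \<union> T' \<and> t < s}
      = {(s, t). s \<in> S \<and> t \<in> T \<and> t < s} \<union> {(s, t). s \<in> S \<and> t \<in> T' \<and> t < s}" by auto
  with assms show ?thesis
    unfolding shuffle_sign_def
    by (subst power_add[symmetric], subst card_Un_disjoint[symmetric]) (auto simp: finite_inversions)
qed

text \<open>Each pair in \<open>S \<times> T\<close> is an inversion in exactly one of the two
  orders, so the two inversion counts add up to \<open>card S * card T\<close>.\<close>

lemma shuffle_sign_commute:
  assumes "finite S" "finite T" "S \<inter> T = {}"
  shows "shuffle_sign T S = (-1) ^ (card S * card T) * shuffle_sign S T"
proof -
  have ne: "s < t \<or> t < s" if "s \<in> S" "t \<in> T" for s t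
    using that assms(3) by (metis IntI empty_iff linorder_neqE_nat)
  have inv: "card {(t, s). t \<in> T \<and> s \<in> S \<and> s < t} = card {(s, t). s \<in> S \<and> t \<in> T \<and> s < t}"
    by (rule bij_betw_same_card[of prod.swap]) (auto simp: bij_betw_def inj_on_def)
  have "S \<times> T = {(s, t). s \<in> S \<and> t \<in> T \<and> s < t} \<union> {(s, t). s \<in> S \<and> t \<in> T \<and> t < s}"
    using ne by auto
  moreover have "finite {(s, t). s \<in> S \<and> t \<in> T \<and> s < t}" "finite {(s, t). s \<in> S \<and> t \<in> T \<and> t < s}"
    using assms by (auto intro: finite_subset[of _ "S \<times> T"])
  moreover have "{(s, t). s \<in> S \<and> t \<in> T \<and> s < t} \<inter> {(s, t). s \<in> S \<and> t \<in> T \<and> t < s} = {}"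
    by auto
  ultimately have "card (S \<times> T) = card {(s, t). s \<in> S \<and> t \<in> T \<and> s < t} + card {(s, t). s \<in> S \<and> t \<in> T \<and> t < s}"
    by (simp only: card_Un_disjoint)
  with inv show ?thesis
    by (simp add: shuffle_sign_def minus_one_power_iff card_cartesian_product)
qed

lemma sum_Pow_complement:
  "(\<Sum>T\<in>Pow S. f T (S - T)) = (\<Sum>T\<in>Pow S. f (S - T) T)"
  by (rule sum.reindex_bij_witness[where i = "\<lambda>T. S - T" and j = "\<lambda>T. S - T"])
    (auto simp: double_diff)

text \<open>Both sides run over the ordered partitions of \<open>S\<close> into three blocks. With
  signs inserted, this is associativity of the exterior product.\<close>

lemma sum_Pow_assoc:
  fixes f :: "'b set \<Rightarrow> 'b set \<Rightarrow> 'b set \<Rightarrow> 'a::comm_monoid_add"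
  assumes "finite S"
  shows "(\<Sum>T\<in>Pow S. \<Sum>U\<in>Pow T. f U (T - U) (S - T)) = (\<Sum>U\<in>Pow S. \<Sum>V\<in>Pow (S - U). f U V (S - U - V))"
proof -
  have Diff: "S - U - (T - U) = S - T" if "U \<subseteq> T" for T U
    using that by auto
  have fin: "T \<in> Pow S \<Longrightarrow> finite (Pow T)" for T
    using assms finite_subset by auto
  have "(\<Sum>T\<in>Pow S. \<Sum>U\<in>Pow T. f U (T - U) (S - T)) = (\<Sum>(T, U)\<in>Sigma (Pow S) Pow. f U (T - U) (S - T))"
    using assms fin by (subst sum.Sigma) auto
  also have "\<dots> = (\<Sum>(U, V)\<in>Sigma (Pow S) (\<lambda>U. Pow (S - U)). f U V (S - U - V))"
    by (rule sum.reindex_bij_witness[where i = "\<lambda>(U, V). (U \<union> V, U)" and j = "\<lambda>(T, U). (U, T - U)"])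
      (auto simp: Diff Un_absorb1)
  also have "\<dots> = (\<Sum>U\<in>Pow S. \<Sum>V\<in>Pow (S - U). f U V (S - U - V))"
    using assms by (subst sum.Sigma) auto
  finally show ?thesis .
qed

text \<open>
  The even part of the exterior algebra over \<open>\<int>\<close> (with infinite sums allowed):
  \<open>f S\<close> is the coefficient of the product of the generators \<open>e\<^sub>s\<close>, \<open>s \<in> S\<close>, in increasing order.
\<close>

typedef even_ext = "{f :: nat set \<Rightarrow> int. \<forall>S. f S \<noteq> 0 \<longrightarrow> finite S \<and> even (card S)}"
  morphisms coef Abs_even_ext
  by (rule exI[of _ "\<lambda>_. 0"]) simp

setup_lifting type_definition_even_ext

lemma coef_eq_0: "infinite S \<or> odd (card S) \<Longrightarrow> coef f S = 0"
  using coef[of f] by auto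

instantiation even_ext :: comm_ring_1
begin

lift_definition zero_even_ext :: even_ext is "\<lambda>_. 0" by simp
lift_definition one_even_ext :: even_ext is "\<lambda>S. if S = {} then 1 else 0"
  by (auto split: if_splits)
lift_definition plus_even_ext :: "even_ext \<Rightarrow> even_ext \<Rightarrow> even_ext" is "\<lambda>f g S. f S + g S"
proof -
  fix f g :: "nat set \<Rightarrow> int" and S
  assume "\<And>S. f S \<noteq> 0 \<Longrightarrow> finite S \<and> even (card S)" "\<And>S. g S \<noteq> 0 \<Longrightarrow> finite S \<and> even (card S)"
    and "f S + g S \<noteq> 0"
  then show "finite S \<and> even (card S)" by (cases "f S = 0") auto
qed
lift_definition uminus_even_ext :: "even_ext \<Rightarrow> even_ext" is "\<lambda>f S. - f S" by simp
lift_definition minus_even_ext :: "even_ext \<Rightarrow> even_ext \<Rightarrow> even_ext" is "\<lambda>f g S. f S - g S"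
proof -
  fix f g :: "nat set \<Rightarrow> int" and S
  assume "\<And>S. f S \<noteq> 0 \<Longrightarrow> finite S \<and> even (card S)" "\<And>S. g S \<noteq> 0 \<Longrightarrow> finite S \<and> even (card S)"
    and "f S - g S \<noteq> 0"
  then show "finite S \<and> even (card S)" by (cases "f S = 0") auto
qed
lift_definition times_even_ext :: "even_ext \<Rightarrow> even_ext \<Rightarrow> even_ext" is
  "\<lambda>f g S. \<Sum>T\<in>Pow S. shuffle_sign T (S - T) * f T * g (S - T)"
proof -
  fix f g :: "nat set \<Rightarrow> int" and S
  assume f: "\<And>S. f S \<noteq> 0 \<Longrightarrow> finite S \<and> even (card S)" and g: "\<And>S. g S \<noteq> 0 \<Longrightarrow> finite S \<and> even (card S)"
    and ne: "(\<Sum>T\<in>Pow S. shuffle_sign T (S - T) * f T * g (S - T)) \<noteq> 0"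
  from ne obtain T where T: "T \<in> Pow S" "f T \<noteq> 0" "g (S - T) \<noteq> 0"
    by (metis (no_types, lifting) mult_eq_0_iff sum.neutral)
  with f g have fin: "finite T" "finite (S - T)" "even (card T)" "even (card (S - T))" by auto
  from fin T have "finite S" using finite_Diff2 by blast
  moreover from this T have "card S = card T + card (S - T)"
    by (simp add: card_Diff_subset card_mono finite_subset)
  ultimately show "finite S \<and> even (card S)" using fin by simp
qed

instance
proof
  fix f g h :: even_ext
  show "f * g * h = f * (g * h)"
  proof (rule coef_inject[THEN iffD1], rule ext)
    fix S :: "nat set"
    show "coef (f * g * h) S = coef (f * (g * h)) S"
    proof (cases "finite S")
      case True
      define F where "F U V W = shuffle_sign U V * shuffle_sign (U \<union> V) W * coef f U * coef g V * coef h W" for U V W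
      define G where "G U V W = shuffle_sign U (V \<union> W) * shuffle_sign V W * coef f U * coef g V * coef h W" for U V W
      have "coef (f * g * h) S = (\<Sum>T\<in>Pow S. \<Sum>U\<in>Pow T. F U (T - U) (S - T))"
        unfolding times_even_ext.rep_eq sum_distrib_left sum_distrib_right F_def
        by (intro sum.cong refl) (simp add: Un_absorb1 mult.assoc mult.left_commute)
      also have "\<dots> = (\<Sum>U\<in>Pow S. \<Sum>V\<in>Pow (S - U). F U V (S - U - V))"
        by (rule sum_Pow_assoc[OF True])
      also have "\<dots> = (\<Sum>U\<in>Pow S. \<Sum>V\<in>Pow (S - U). G U V (S - U - V))"
      proof (intro sum.cong refl)
        fix U V assume UV: "U \<in> Pow S" "V \<in> Pow (S - U)"
        with True have fin: "finite U" "finite V" "finite (S - U - V)"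
          by (auto intro: finite_subset)
        moreover from UV have "U \<inter> V = {}" "V \<inter> (S - U - V) = {}" by auto
        ultimately show "F U V (S - U - V) = G U V (S - U - V)"
          by (simp add: F_def G_def shuffle_sign_union_left shuffle_sign_union_right del: Un_Diff_cancel)
      qed
      also have "\<dots> = coef (f * (g * h)) S"
        unfolding times_even_ext.rep_eq sum_distrib_left sum_distrib_right G_def
        by (intro sum.cong refl) (simp add: Un_absorb1 mult.assoc mult.left_commute)
      finally show ?thesis .
    qed (simp add: coef_eq_0)
  qed
  show "f * g = g * f"
  proof (rule coef_inject[THEN iffD1], rule ext)
    fix S :: "nat set"
    \<comment> \<open>Commutativity is where evenness matters: moving \<open>T\<close> past its
      complement costs the sign \<open>(-1)^(card (S - T) * card T)\<close>, which is 1 for even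
      \<open>card T\<close>; for odd \<open>card T\<close> both coefficients at \<open>T\<close>
      vanish.\<close>
    have *: "shuffle_sign T (S - T) * coef f T * coef g (S - T) = shuffle_sign (S - T) T * coef g (S - T) * coef f T"
      if "T \<in> Pow S" for T
    proof (cases "finite T \<and> finite (S - T) \<and> even (card T)")
      case True
      then show ?thesis by (subst shuffle_sign_commute[of "S - T" T]) auto
    qed (auto simp: coef_eq_0)
    show "coef (f * g) S = coef (g * f) S"
      unfolding times_even_ext.rep_eq
      by (subst sum_Pow_complement[of "\<lambda>T U. shuffle_sign T U * coef g T * coef f U"]) (intro sum.cong refl *)
  qed
  show "1 * f = f"
  proof (rule coef_inject[THEN iffD1], rule ext)
    fix S :: "nat set"
    show "coef (1 * f) S = coef f S"
    proof (cases "finite S")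
      case True
      have "coef (1 * f) S = (\<Sum>T\<in>Pow S. if T = {} then coef f S else 0)"
        unfolding times_even_ext.rep_eq one_even_ext.rep_eq by (intro sum.cong refl) auto
      then show ?thesis using True by simp
    qed (simp add: coef_eq_0)
  qed
  show "(f + g) * h = f * h + g * h"
    by transfer (simp add: algebra_simps sum.distrib)
  show "(0::even_ext) \<noteq> 1" by transfer (meson zero_neq_one)
  show "f + g + h = f + (g + h)" by transfer (simp add: add.assoc)
  show "f + g = g + f" by transfer (simp add: add.commute)
  show "0 + f = f" by transfer simp
  show "- f + f = 0" by transfer simp
  show "f - g = f + - g" by transfer simp
qed

end

lemma coef_of_nat_mult: "coef (of_nat k * f) S = int k * coef f S"
  by (induction k) (simp_all add: zero_even_ext.rep_eq plus_even_ext.rep_eq algebra_simps)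

text \<open>The reason for integer coefficients: the relation between \<open>k p_k\<close> and the
  trace in the nilpotency criterion must be divided by \<open>k\<close>.\<close>

lemma even_ext_torsion_free:
  assumes "k > 0" and "of_nat k * (f::even_ext) = 0"
  shows "f = 0"
proof (rule coef_inject[THEN iffD1], rule ext)
  fix S
  from assms(2) coef_of_nat_mult[of k f S] show "coef f S = coef 0 S"
    using assms(1) by (simp add: zero_even_ext.rep_eq)
qed

lemma coef_sum: "coef (sum f A) S = (\<Sum>x\<in>A. coef (f x) S)"
  by (induction A rule: infinite_finite_induct) (simp_all add: zero_even_ext.rep_eq plus_even_ext.rep_eq)

section \<open>Standard polynomials\<close>

text \<open>The standard polynomial in the arguments \<open>a x\<close>, \<open>x \<in> S\<close>,
  expanded by its first factor. Recursion over subsets replaces sums over permutations, and the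
  shuffle signs accumulate the permutation sign. The value 1 is the empty product, and a dummy for
  infinite \<open>S\<close>.\<close>

function stdp :: "(nat \<Rightarrow> 'r::ring_1) \<Rightarrow> nat set \<Rightarrow> 'r" where
  "stdp a S = (if finite S \<and> S \<noteq> {}
     then \<Sum>x\<in>S. of_int (shuffle_sign {x} (S - {x})) * a x * stdp a (S - {x}) else 1)"
  by auto
termination
  by (relation "measure (\<lambda>(a, S). card S)") (auto simp: card_gt_0_iff)

declare stdp.simps [simp del]

lemma stdp_empty [simp]: "stdp a {} = 1"
  by (simp add: stdp.simps)

lemma stdp_rec:
  "finite S \<Longrightarrow> S \<noteq> {} \<Longrightarrow>
    stdp a S = (\<Sum>x\<in>S. of_int (shuffle_sign {x} (S - {x})) * a x * stdp a (S - {x}))"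
  by (subst stdp.simps) simp

lemma stdp_singleton [simp]: "stdp a {x} = a x"
  by (simp add: stdp_rec)

lemma finite_remove_induct' [consumes 1, case_names empty remove]:
  assumes "finite S" and "P {}"
    and step: "\<And>S. finite S \<Longrightarrow> S \<noteq> {} \<Longrightarrow> (\<And>x. x \<in> S \<Longrightarrow> P (S - {x})) \<Longrightarrow> P S"
  shows "P S"
  using assms(1)
proof (induction "card S" arbitrary: S)
  case (Suc n)
  show ?case
  proof (rule step)
    show "P (S - {x})" if "x \<in> S" for x
      using Suc that by (intro Suc.hyps(1)) simp_all
  qed (use Suc in auto)
qed (simp add: assms(2))

lemma stdp_cong:
  assumes "finite S" and "\<And>x. x \<in> S \<Longrightarrow> a x = b x"
  shows "stdp a S = stdp b S"
  using assms
proof (induction S rule: finite_remove_induct')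
  case (remove S)
  then show ?case by (simp add: stdp_rec cong: sum.cong)
qed simp

text \<open>As in the Laplace expansion of a determinant, the words are grouped by the set
  \<open>T\<close> of their first \<open>m\<close> letters. The induction splits off the first
  letter \<open>x\<close>, then \<open>m\<close> more letters, and regroups the pairs
  \<open>(x, T)\<close> by \<open>insert x T\<close>.\<close>

lemma stdp_laplace:
  fixes a :: "nat \<Rightarrow> 'r::ring_1"
  assumes "finite S" and "m \<le> card S"
  shows "stdp a S = (\<Sum>T | T \<subseteq> S \<and> card T = m. of_int (shuffle_sign T (S - T)) * stdp a T * stdp a (S - T))"
  using assms
proof (induction m arbitrary: S)
  case 0
  then have "{T. T \<subseteq> S \<and> card T = 0} = {{}}" by (auto simp: finite_subset)
  then show ?case by simp
next
  case (Suc m)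
  have ne: "S \<noteq> {}" using Suc.prems by auto
  have fin: "finite {T. T \<subseteq> S' \<and> card T = k}" if "S' \<subseteq> S" for S' k
    using that Suc.prems(1) by (auto intro!: finite_subset[of _ "Pow S"])
  define F where "F x T = of_int (shuffle_sign {x} T * shuffle_sign {x} (S - {x} - T) * shuffle_sign T (S - {x} - T))
    * (a x * stdp a T * stdp a (S - {x} - T))" for x T
  have "stdp a S = (\<Sum>x\<in>S. \<Sum>T | T \<subseteq> S - {x} \<and> card T = m. F x T)"
  proof -
    have "of_int (shuffle_sign {x} (S - {x})) * a x * stdp a (S - {x}) = (\<Sum>T | T \<subseteq> S - {x} \<and> card T = m. F x T)"
      if x: "x \<in> S" for x
    proof -
      have "stdp a (S - {x}) = (\<Sum>T | T \<subseteq> S - {x} \<and> card T = m.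
          of_int (shuffle_sign T (S - {x} - T)) * stdp a T * stdp a (S - {x} - T))"
        using Suc.prems x by (intro Suc.IH) auto
      moreover have "of_int (shuffle_sign {x} (S - {x})) * a x
          * (of_int (shuffle_sign T (S - {x} - T)) * stdp a T * stdp a (S - {x} - T)) = F x T"
        if T: "T \<subseteq> S - {x}" for T
      proof -
        have "S - {x} = T \<union> (S - {x} - T)" using T by auto
        then have "shuffle_sign {x} (S - {x}) = shuffle_sign {x} T * shuffle_sign {x} (S - {x} - T)"
          using shuffle_sign_union_right[of "{x}" T "S - {x} - T"] T Suc.prems(1)
          by (metis Diff_disjoint finite.emptyI finite.insertI finite_Diff finite_subset)
        moreover have "of_int k * y * (of_int l * z * w) = of_int (k * l) * (y * z * w)" for k l and y z w :: 'r
          using mult_of_int_commute[of l y] by (simp add: mult.assoc) (metis mult.assoc)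
        ultimately show ?thesis by (simp only: F_def)
      qed
      ultimately show ?thesis by (simp add: sum_distrib_left)
    qed
    then show ?thesis using Suc.prems(1) ne by (simp add: stdp_rec)
  qed
  also have "\<dots> = (\<Sum>(x, T)\<in>Sigma S (\<lambda>x. {T. T \<subseteq> S - {x} \<and> card T = m}). F x T)"
    using Suc.prems(1) fin by (subst sum.Sigma) auto
  also have "\<dots> = (\<Sum>(T, x)\<in>Sigma {T. T \<subseteq> S \<and> card T = Suc m} (\<lambda>T. T). F x (T - {x}))"
    by (rule sum.reindex_bij_witness[where i = "\<lambda>(T, x). (x, T - {x})" and j = "\<lambda>(x, T). (insert x T, x)"])
      (use Suc.prems(1) in \<open>auto simp: card_insert_if finite_subset insert_absorb subset_Diff_insert\<close>)
  also have "\<dots> = (\<Sum>T | T \<subseteq> S \<and> card T = Suc m. \<Sum>x\<in>T. F x (T - {x}))"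
    using fin[of S] finite_subset[OF _ Suc.prems(1)] by (subst sum.Sigma) auto
  also have "\<dots> = (\<Sum>T | T \<subseteq> S \<and> card T = Suc m. of_int (shuffle_sign T (S - T)) * stdp a T * stdp a (S - T))"
  proof (intro sum.cong refl)
    fix T assume "T \<in> {T. T \<subseteq> S \<and> card T = Suc m}"
    then have T: "T \<subseteq> S" "finite T" "T \<noteq> {}" using Suc.prems(1) finite_subset by auto
    have "F x (T - {x}) = of_int (shuffle_sign T (S - T)) * (of_int (shuffle_sign {x} (T - {x})) * a x * stdp a (T - {x})) * stdp a (S - T)"
      if x: "x \<in> T" for x
    proof -
      have diff: "S - {x} - (T - {x}) = S - T" using x by auto
      have "shuffle_sign T (S - T) = shuffle_sign {x} (S - T) * shuffle_sign (T - {x}) (S - T)"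
        using shuffle_sign_union_left[of "{x}" "T - {x}" "S - T"] x T Suc.prems(1)
        by (simp add: insert_absorb)
      then have "shuffle_sign {x} (T - {x}) * shuffle_sign {x} (S - T) * shuffle_sign (T - {x}) (S - T)
          = shuffle_sign T (S - T) * shuffle_sign {x} (T - {x})"
        by simp
      moreover have "of_int k * (of_int l * y * z) * w = of_int (k * l) * (y * z * w)" for k l and y z w :: 'r
        by (simp add: mult.assoc)
      ultimately show ?thesis by (simp only: F_def diff)
    qed
    with T show "(\<Sum>x\<in>T. F x (T - {x})) = of_int (shuffle_sign T (S - T)) * stdp a T * stdp a (S - T)"
      by (simp add: stdp_rec[of T] sum_distrib_left sum_distrib_right)
  qed
  finally show ?case .
qed

text \<open>The Laplace expansion with \<open>m = card S - 1\<close>, that is, by the last factor.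
  Together with \<open>stdp_rec\<close> it allows a factor to be moved cyclically under the
  trace.\<close>

lemma stdp_rec_right:
  assumes "finite S" "S \<noteq> {}"
  shows "stdp a S = (\<Sum>x\<in>S. of_int (shuffle_sign (S - {x}) {x}) * stdp a (S - {x}) * a x)"
proof -
  have "stdp a S = (\<Sum>T | T \<subseteq> S \<and> card T = card S - 1. of_int (shuffle_sign T (S - T)) * stdp a T * stdp a (S - T))"
    using assms by (intro stdp_laplace) auto
  also have "{T. T \<subseteq> S \<and> card T = card S - 1} = (\<lambda>x. S - {x}) ` S"
  proof (intro equalityI subsetI)
    fix T assume "T \<in> {T. T \<subseteq> S \<and> card T = card S - 1}"
    then have T: "T \<subseteq> S" "card T = card S - 1" by auto
    with assms have "card (S - T) = 1"
      by (simp add: card_Diff_subset finite_subset card_gt_0_iff Suc_leI)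
    then obtain x where "S - T = {x}" by (auto simp: card_1_singleton_iff)
    with T show "T \<in> (\<lambda>x. S - {x}) ` S" by blast
  qed (use assms in auto)
  also have "(\<Sum>T\<in>(\<lambda>x. S - {x}) ` S. of_int (shuffle_sign T (S - T)) * stdp a T * stdp a (S - T))
     = (\<Sum>x\<in>S. of_int (shuffle_sign (S - {x}) {x}) * stdp a (S - {x}) * a x)"
    by (subst sum.reindex) (auto simp: inj_on_def double_diff intro!: sum.cong)
  finally show ?thesis .
qed

section \<open>Linear operators and their finite blocks\<close>

text \<open>Matrices whose size is a variable do not form a ring type; linear operators on all
  functions \<open>'i \<Rightarrow> 'c\<close> do. They also accommodate the infinite-dimensional
  representation, and finite matrices reappear as blocks through \<open>local_on\<close>.\<close>

typedef (overloaded) ('i, 'c) lop = "{T :: ('i \<Rightarrow> 'c::comm_ring_1) \<Rightarrow> 'i \<Rightarrow> 'c.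
    (\<forall>u v. T (\<lambda>z. u z + v z) = (\<lambda>z. T u z + T v z)) \<and> (\<forall>c v. T (\<lambda>z. c * v z) = (\<lambda>z. c * T v z))}"
  morphisms app Abs_lop
  by (rule exI[of _ id]) simp

setup_lifting type_definition_lop

lemma app_scale_right: "app T (\<lambda>z. c * v z) = (\<lambda>z. c * app T v z)"
  using app[of T] by simp

instantiation lop :: (type, comm_ring_1) ring_1
begin

lift_definition zero_lop :: "('a, 'b) lop" is "\<lambda>v z. 0" by simp
lift_definition one_lop :: "('a, 'b) lop" is "\<lambda>v. v" by simp
lift_definition plus_lop :: "('a, 'b) lop \<Rightarrow> ('a, 'b) lop \<Rightarrow> ('a, 'b) lop" is "\<lambda>S T v z. S v z + T v z"
  by (auto simp: algebra_simps)
lift_definition uminus_lop :: "('a, 'b) lop \<Rightarrow> ('a, 'b) lop" is "\<lambda>T v z. - T v z" by auto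
lift_definition minus_lop :: "('a, 'b) lop \<Rightarrow> ('a, 'b) lop \<Rightarrow> ('a, 'b) lop" is "\<lambda>S T v z. S v z - T v z"
  by (auto simp: algebra_simps)
lift_definition times_lop :: "('a, 'b) lop \<Rightarrow> ('a, 'b) lop \<Rightarrow> ('a, 'b) lop" is "\<lambda>S T v. S (T v)" by auto

instance
proof
  show "(0 :: ('a, 'b) lop) \<noteq> 1"
  proof
    assume "(0 :: ('a, 'b) lop) = 1"
    then have "app (0 :: ('a, 'b) lop) (\<lambda>_. 1) undefined = app 1 (\<lambda>_. 1) undefined" by simp
    then show False by (simp add: zero_lop.rep_eq one_lop.rep_eq)
  qed
qed (transfer; simp add: algebra_simps fun_eq_iff)+

end

lemmas app_simps = zero_lop.rep_eq one_lop.rep_eq plus_lop.rep_eq uminus_lop.rep_eq minus_lop.rep_eq times_lop.rep_eq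

lemma lop_eqI: "(\<And>v z. app S v z = app T v z) \<Longrightarrow> S = T"
  by (simp add: app_inject[symmetric] fun_eq_iff)

lemma app_sum: "app (sum f A) v z = (\<Sum>x\<in>A. app (f x) v z)"
  by (induction A rule: infinite_finite_induct) (simp_all add: app_simps)

lemma app_of_int: "app (of_int k) v z = of_int k * v z"
proof -
  have "app (of_nat n) v z = of_nat n * v z" for n
    by (induction n) (simp_all add: app_simps algebra_simps)
  then show ?thesis by (cases k rule: int_cases2) (simp_all add: app_simps)
qed

lift_definition scal :: "'c \<Rightarrow> ('i, 'c::comm_ring_1) lop" is "\<lambda>c v z. c * v z"
  by (simp add: algebra_simps)

lemma scal_commute: "scal c * T = T * scal c"
  by (rule lop_eqI) (simp add: app_simps scal.rep_eq app_scale_right)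

lemma scal_add: "scal (c + d) = scal c + scal d"
  and scal_mult: "scal (c * d) = scal c * scal d"
  and scal_1 [simp]: "scal 1 = 1"
  and scal_0 [simp]: "scal 0 = 0"
  by (rule lop_eqI; simp add: app_simps scal.rep_eq algebra_simps)+

definition entry :: "('i, 'c::comm_ring_1) lop \<Rightarrow> 'i \<Rightarrow> 'i \<Rightarrow> 'c" where
  "entry T z z' = app T (\<lambda>w. if w = z' then 1 else 0) z"

text \<open>Over an infinite index type the entries do not determine an operator. For finite
  \<open>I\<close> this condition says that \<open>T v\<close> on \<open>I\<close> depends only on
  \<open>v\<close> on \<open>I\<close>, through the entries, so that restriction to the block
  \<open>I\<close> is multiplicative.\<close>

definition local_on :: "'i set \<Rightarrow> ('i, 'c::comm_ring_1) lop \<Rightarrow> bool" where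
  "local_on I T \<longleftrightarrow> (\<forall>v. \<forall>z\<in>I. app T v z = (\<Sum>w\<in>I. entry T z w * v w))"

lemma local_onI:
  assumes fin: "finite I" and "\<And>v z. z \<in> I \<Longrightarrow> app T v z = (\<Sum>w\<in>I. t z w * v w)"
  shows "local_on I T"
proof -
  have "entry T z w = t z w" if "z \<in> I" "w \<in> I" for z w
  proof -
    have "entry T z w = (\<Sum>w'\<in>I. if w' = w then t z w' else 0)"
      unfolding entry_def assms(2)[OF that(1)] by (intro sum.cong) auto
    with fin that show ?thesis by simp
  qed
  with assms show ?thesis by (simp add: local_on_def)
qed

lemma local_onD: "local_on I T \<Longrightarrow> z \<in> I \<Longrightarrow> app T v z = (\<Sum>w\<in>I. entry T z w * v w)"
  by (simp add: local_on_def)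

lemma entry_simps:
  "entry 0 z w = 0" "entry 1 z w = (if z = w then 1 else 0)"
  "entry (S + T) z w = entry S z w + entry T z w"
  "entry (of_int k * T) z w = of_int k * entry T z w"
  "entry (scal c * T) z w = c * entry T z w"
  "entry (sum f A) z w = (\<Sum>x\<in>A. entry (f x) z w)"
  by (simp_all add: entry_def app_simps app_of_int app_sum scal.rep_eq)

lemma entry_mult:
  "local_on I S \<Longrightarrow> z \<in> I \<Longrightarrow> entry (S * T) z w = (\<Sum>y\<in>I. entry S z y * entry T y w)"
  by (simp add: entry_def[of "S * T"] entry_def[of T] app_simps local_onD)

lemma local_on_mult:
  assumes "finite I" "local_on I S" "local_on I T"
  shows "local_on I (S * T)"
proof (rule local_onI[OF assms(1), where t = "\<lambda>z w. \<Sum>y\<in>I. entry S z y * entry T y w"])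
  fix v z assume "z \<in> I"
  then have "app (S * T) v z = (\<Sum>y\<in>I. \<Sum>w\<in>I. entry S z y * (entry T y w * v w))"
    using assms by (simp add: app_simps local_onD[of I] sum_distrib_left)
  also have "\<dots> = (\<Sum>w\<in>I. \<Sum>y\<in>I. entry S z y * (entry T y w * v w))"
    by (rule sum.swap)
  finally show "app (S * T) v z = (\<Sum>w\<in>I. (\<Sum>y\<in>I. entry S z y * entry T y w) * v w)"
    by (simp add: sum_distrib_right mult.assoc)
qed

lemma local_on_0 [simp]: "local_on I 0"
  by (simp add: local_on_def entry_simps app_simps)

lemma local_on_1 [simp]: "finite I \<Longrightarrow> local_on I 1"
  by (simp add: local_on_def entry_simps app_simps if_distrib[of "\<lambda>x. x * _"] cong: if_cong)

lemma local_on_add: "local_on I S \<Longrightarrow> local_on I T \<Longrightarrow> local_on I (S + T)"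
  by (simp add: local_on_def entry_simps app_simps algebra_simps sum.distrib)

lemma local_on_scal: "local_on I T \<Longrightarrow> local_on I (scal c * T)"
  by (simp add: local_on_def entry_simps app_simps scal.rep_eq sum_distrib_left mult.assoc)

lemma local_on_of_int: "local_on I T \<Longrightarrow> local_on I (of_int k * T)"
  by (simp add: local_on_def entry_simps app_simps app_of_int sum_distrib_left mult.assoc)

lemma local_on_sum: "(\<And>x. x \<in> A \<Longrightarrow> local_on I (f x)) \<Longrightarrow> local_on I (sum f A)"
  by (induction A rule: infinite_finite_induct) (simp_all add: local_on_add)

lemma local_on_stdp:
  assumes I: "finite I" and a: "\<And>x. local_on I (a x)"
  shows "local_on I (stdp a S)"
proof (cases "finite S")
  case True
  then show ?thesis
  proof (induction S rule: finite_remove_induct')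
    case (remove S)
    then show ?case
      by (simp add: stdp_rec mult.assoc local_on_sum local_on_of_int local_on_mult I a)
  qed (simp add: I)
qed (simp add: stdp.simps I)

definition trace_on :: "'i set \<Rightarrow> ('i, 'c::comm_ring_1) lop \<Rightarrow> 'c" where
  "trace_on I T = (\<Sum>z\<in>I. entry T z z)"

lemma trace_on_commute:
  assumes "local_on I S" "local_on I T"
  shows "trace_on I (S * T) = trace_on I (T * S)"
proof -
  have "trace_on I (S * T) = (\<Sum>z\<in>I. \<Sum>y\<in>I. entry S z y * entry T y z)"
    using assms by (simp add: trace_on_def entry_mult)
  also have "\<dots> = (\<Sum>y\<in>I. \<Sum>z\<in>I. entry T y z * entry S z y)"
    by (subst sum.swap) (simp add: mult.commute)
  also have "\<dots> = trace_on I (T * S)"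
    using assms by (simp add: trace_on_def entry_mult)
  finally show ?thesis .
qed

lemma trace_on_simps:
  "trace_on I (of_int k * T) = of_int k * trace_on I T"
  "trace_on I (sum f A) = (\<Sum>x\<in>A. trace_on I (f x))"
  unfolding trace_on_def entry_simps by (simp_all add: sum_distrib_left sum.swap[of _ I A])

text \<open>Under the trace the last factor may be moved to the front. For an even number of factors
  this cyclic shift is an odd permutation, so the trace equals its own negative, and over the
  integers it is 0.\<close>

lemma trace_on_stdp:
  fixes a :: "nat \<Rightarrow> ('i, int) lop"
  assumes I: "finite I" and a: "\<And>x. local_on I (a x)" and S: "finite S" "S \<noteq> {}" "even (card S)"
  shows "trace_on I (stdp a S) = 0"
proof -
  have sgn: "shuffle_sign (S - {x}) {x} = - shuffle_sign {x} (S - {x})" if "x \<in> S" for x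
  proof -
    have "odd (card (S - {x}))" using S that by (simp add: card_gt_0_iff)
    then show ?thesis using S shuffle_sign_commute[of "{x}" "S - {x}"] by simp
  qed
  have "trace_on I (stdp a S) = (\<Sum>x\<in>S. shuffle_sign (S - {x}) {x} * trace_on I (stdp a (S - {x}) * a x))"
    unfolding stdp_rec_right[OF S(1,2)] trace_on_simps mult.assoc by simp
  also have "\<dots> = (\<Sum>x\<in>S. - (shuffle_sign {x} (S - {x}) * trace_on I (a x * stdp a (S - {x}))))"
    by (intro sum.cong refl) (simp add: sgn trace_on_commute[OF local_on_stdp[OF I a] a])
  also have "\<dots> = - trace_on I (stdp a S)"
    unfolding stdp_rec[OF S(1,2)] trace_on_simps mult.assoc by (simp add: sum_negf)
  finally show ?thesis by simp
qed

section \<open>The Amitsur--Levitzki theorem over the integers\<close>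

lemma coef_times: "coef (f * g) S = (\<Sum>T\<in>Pow S. shuffle_sign T (S - T) * coef f T * coef g (S - T))"
  by (simp add: times_even_ext.rep_eq)

text \<open>
  Rosset's argument: put \<open>a = \<Sum> a\<^sub>x e\<^sub>x\<close> with exterior generators \<open>e\<^sub>x\<close>. The matrix \<open>a\<^sup>2\<close> has entries
  in a commutative torsion-free ring, and the coefficients of its powers are the standard
  polynomials of even degree. These have trace \<open>0\<close>, so \<open>a\<^sup>2\<close> is nilpotent.
\<close>

lemma amitsur_levitzki_int:
  fixes a :: "nat \<Rightarrow> ('i, int) lop"
  assumes I: "finite I" and a: "\<And>x. local_on I (a x)"
    and S: "finite S" "card S = 2 * card I" and zw: "z \<in> I" "w \<in> I"
  shows "entry (stdp a S) z w = 0"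
proof -
  define n where "n = card I"
  obtain e where e: "bij_betw e {..<n} I"
    using ex_bij_betw_nat_finite[OF I] by (auto simp: n_def atLeast0LessThan)
  \<comment> \<open>\<open>E k i j\<close> is entry \<open>(i, j)\<close> of \<open>a^(2k)\<close>.
    Only even powers are formed, so all entries lie in the commutative even part.\<close>
  define E where "E k i j = Abs_even_ext (\<lambda>T. if finite T \<and> card T = 2 * k then entry (stdp a T) (e i) (e j) else 0)"
    for k i j
  have coef_E: "coef (E k i j) T = (if finite T \<and> card T = 2 * k then entry (stdp a T) (e i) (e j) else 0)" for k i j T
    unfolding E_def by (subst Abs_even_ext_inverse) auto
  have E_mult: "(\<Sum>l<n. E k i l * E 1 l j) = E (Suc k) i j" if "i < n" for k i j
  proof (rule coef_inject[THEN iffD1], rule ext)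
    fix T :: "nat set"
    show "coef (\<Sum>l<n. E k i l * E 1 l j) T = coef (E (Suc k) i j) T"
    proof (cases "finite T")
      case fin: True
      have "coef (\<Sum>l<n. E k i l * E 1 l j) T
          = (\<Sum>l<n. \<Sum>U\<in>Pow T. shuffle_sign U (T - U) * coef (E k i l) U * coef (E 1 l j) (T - U))"
        by (simp add: coef_sum coef_times)
      also have "\<dots> = (\<Sum>U\<in>Pow T. \<Sum>l<n. shuffle_sign U (T - U) * coef (E k i l) U * coef (E 1 l j) (T - U))"
        by (rule sum.swap)
      also have "\<dots> = (\<Sum>U\<in>Pow T. if card U = 2 * k \<and> card (T - U) = 2
          then shuffle_sign U (T - U) * entry (stdp a U * stdp a (T - U)) (e i) (e j) else 0)"
      proof (intro sum.cong refl)
        fix U assume "U \<in> Pow T"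
        with fin have fU: "finite U" "finite (T - U)" by (auto intro: finite_subset)
        have "e i \<in> I" using e that by (auto simp: bij_betw_def)
        then have "entry (stdp a U * stdp a (T - U)) (e i) (e j)
            = (\<Sum>y\<in>I. entry (stdp a U) (e i) y * entry (stdp a (T - U)) y (e j))"
          by (intro entry_mult local_on_stdp I a)
        also have "\<dots> = (\<Sum>l<n. entry (stdp a U) (e i) (e l) * entry (stdp a (T - U)) (e l) (e j))"
          by (rule sum.reindex_bij_betw[OF e, symmetric])
        finally show "(\<Sum>l<n. shuffle_sign U (T - U) * coef (E k i l) U * coef (E 1 l j) (T - U))
          = (if card U = 2 * k \<and> card (T - U) = 2
             then shuffle_sign U (T - U) * entry (stdp a U * stdp a (T - U)) (e i) (e j) else 0)"
          using fU by (auto simp: coef_E sum_distrib_left mult.assoc intro!: sum.neutral)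
      qed
      also have "\<dots> = (if card T = 2 * Suc k then entry (stdp a T) (e i) (e j) else 0)"
      proof (cases "card T = 2 * Suc k")
        case True
        have "card (T - U) = 2" if "U \<subseteq> T" "card U = 2 * k" for U
          using that True fin by (simp add: card_Diff_subset finite_subset)
        then have "(\<Sum>U\<in>Pow T. if card U = 2 * k \<and> card (T - U) = 2
            then shuffle_sign U (T - U) * entry (stdp a U * stdp a (T - U)) (e i) (e j) else 0)
          = (\<Sum>U | U \<subseteq> T \<and> card U = 2 * k. shuffle_sign U (T - U) * entry (stdp a U * stdp a (T - U)) (e i) (e j))"
          using fin by (intro sum.mono_neutral_cong_right) auto
        also have "\<dots> = entry (stdp a T) (e i) (e j)"
          using True fin by (subst stdp_laplace[of T "2 * k"]) (simp_all add: entry_simps mult.assoc)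
        finally show ?thesis using True by simp
      next
        case False
        have "\<not> (card U = 2 * k \<and> card (T - U) = 2)" if "U \<subseteq> T" for U
          using that False fin card_mono[OF fin that] by (auto simp: card_Diff_subset finite_subset)
        then show ?thesis using False by (auto intro!: sum.neutral)
      qed
      also have "\<dots> = coef (E (Suc k) i j) T" using fin by (simp add: coef_E)
      finally show ?thesis .
    qed (simp add: coef_eq_0)
  qed
  define B where "B = mat n n (\<lambda>(i, j). E 1 i j)"
  have B: "B \<in> carrier_mat n n" by (simp add: B_def)
  have B_ij: "B $$ (i, j) = E 1 i j" if "i < n" "j < n" for i j
    using that by (simp add: B_def)
  have pow: "B ^\<^sub>m k = mat n n (\<lambda>(i, j). E k i j)" for k
  proof (induction k)
    case 0
    have "E 0 i j = (if i = j then 1 else 0)" if "i < n" "j < n" for i j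
    proof (rule coef_inject[THEN iffD1], rule ext)
      fix T
      have "e i = e j \<longleftrightarrow> i = j" using e that by (auto simp: bij_betw_def inj_on_def)
      then show "coef (E 0 i j) T = coef (if i = j then 1 else 0) T"
        by (auto simp: coef_E zero_even_ext.rep_eq one_even_ext.rep_eq entry_simps)
    qed
    then show ?case using B by (intro eq_matI) auto
  next
    case (Suc k)
    show ?case
    proof (rule eq_matI)
      fix i j assume ij: "i < dim_row (mat n n (\<lambda>(i, j). E (Suc k) i j))" "j < dim_col (mat n n (\<lambda>(i, j). E (Suc k) i j))"
      then have "(B ^\<^sub>m Suc k) $$ (i, j) = (\<Sum>l<n. E k i l * E 1 l j)"
        using B by (simp add: Suc B_ij scalar_prod_def atLeast0LessThan)
      with ij show "(B ^\<^sub>m Suc k) $$ (i, j) = mat n n (\<lambda>(i, j). E (Suc k) i j) $$ (i, j)"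
        by (simp add: E_mult[unfolded One_nat_def])
    qed (use B in \<open>simp_all add: Suc\<close>)
  qed
  have "B ^\<^sub>m n = 0\<^sub>m n n"
  proof (rule nilpotent_of_trace_power_eq_0[OF B])
    show "(\<Sum>i<n. (B ^\<^sub>m k) $$ (i, i)) = 0" if "k > 0" for k
    proof (rule coef_inject[THEN iffD1], rule ext)
      fix T
      have "coef (\<Sum>i<n. (B ^\<^sub>m k) $$ (i, i)) T = (\<Sum>i<n. coef (E k i i) T)"
        by (simp add: pow coef_sum)
      also have "\<dots> = (if finite T \<and> card T = 2 * k then \<Sum>i<n. entry (stdp a T) (e i) (e i) else 0)"
        by (cases "finite T \<and> card T = 2 * k") (auto simp: coef_E)
      also have "(\<Sum>i<n. entry (stdp a T) (e i) (e i)) = trace_on I (stdp a T)"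
        unfolding trace_on_def by (rule sum.reindex_bij_betw[OF e])
      also have "(if finite T \<and> card T = 2 * k then trace_on I (stdp a T) else 0) = 0"
        using \<open>k > 0\<close> by (auto intro!: trace_on_stdp I a)
      finally show "coef (\<Sum>i<n. (B ^\<^sub>m k) $$ (i, i)) T = coef 0 T"
        by (simp add: zero_even_ext.rep_eq)
    qed
  qed (rule even_ext_torsion_free)
  moreover obtain i j where "i < n" "z = e i" "j < n" "w = e j"
    using zw e by (auto simp: bij_betw_def)
  moreover have "coef ((B ^\<^sub>m n) $$ (i, j)) S = entry (stdp a S) (e i) (e j)" if "i < n" "j < n" for i j
    using that S by (simp add: pow coef_E n_def)
  ultimately show ?thesis by (auto simp: zero_even_ext.rep_eq)
qed

section \<open>Transfer to arbitrary commutative rings\<close>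

lift_definition unit_lop :: "'i \<Rightarrow> 'i \<Rightarrow> ('i, 'c::comm_ring_1) lop" is "\<lambda>p q v z. if z = p then v q else 0"
  by auto

lemma entry_unit: "entry (unit_lop p q) z w = (if z = p \<and> w = q then 1 else 0)"
  by (auto simp: entry_def unit_lop.rep_eq)

lemma entry_unit_mult: "entry (unit_lop p q * T) z w = (if z = p then entry T q w else 0)"
  by (simp add: entry_def app_simps unit_lop.rep_eq)

lemma local_on_unit: "finite I \<Longrightarrow> q \<in> I \<Longrightarrow> local_on I (unit_lop p q)"
  by (auto simp: local_on_def entry_unit unit_lop.rep_eq if_distrib[of "\<lambda>x. x * _"] cong: if_cong)

text \<open>Matrix units have entries 0 and 1 over every ring, so evaluating a standard polynomial
  at them takes place in the image of the integers. This is the bridge to positive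
  characteristic.\<close>

lemma entry_stdp_unit:
  fixes p q :: "nat \<Rightarrow> 'i"
  assumes "finite S"
  shows "entry (stdp (\<lambda>x. unit_lop (p x) (q x)) S) z w
    = (of_int (entry (stdp (\<lambda>x. unit_lop (p x) (q x)) S) z w) :: 'c::comm_ring_1)"
  using assms
proof (induction S arbitrary: z rule: finite_remove_induct')
  case (remove S)
  have "of_int (entry (stdp (\<lambda>x. unit_lop (p x) (q x)) (S - {x})) (q x) w)
      = entry (stdp (\<lambda>x. unit_lop (p x) (q x) :: ('i, 'c) lop) (S - {x})) (q x) w" if "x \<in> S" for x
    using remove.IH[OF that] by simp
  then show ?case
    unfolding stdp_rec[OF remove.hyps] entry_simps mult.assoc entry_unit_mult of_int_sum of_int_mult
    by (intro sum.cong refl) simp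
qed (simp add: entry_simps)

text \<open>Multilinearity in the argument \<open>y\<close>, with \<open>a y\<close> written in
  matrix units. That expansion is valid only on the block \<open>I\<close>, hence the formulation
  with entries instead of operators.\<close>

lemma entry_stdp_expand:
  fixes a :: "nat \<Rightarrow> ('i, 'c::comm_ring_1) lop"
  assumes I: "finite I" and a: "\<And>x. local_on I (a x)" and "finite S" "y \<in> S" "z \<in> I" "w \<in> I"
  shows "entry (stdp a S) z w
    = (\<Sum>p\<in>I. \<Sum>q\<in>I. entry (a y) p q * entry (stdp (a(y := unit_lop p q)) S) z w)"
  using assms(3-6)
proof (induction S arbitrary: z rule: finite_remove_induct')
  case (remove S)
  have ne: "S \<noteq> {}" using remove by auto
  have "of_int (shuffle_sign {x} (S - {x})) * entry (a x * stdp a (S - {x})) z w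
    = (\<Sum>p\<in>I. \<Sum>q\<in>I. entry (a y) p q * (of_int (shuffle_sign {x} (S - {x}))
         * entry ((a(y := unit_lop p q)) x * stdp (a(y := unit_lop p q)) (S - {x})) z w))"
    if x: "x \<in> S" for x
  proof (cases "x = y")
    case True
    have cong: "stdp (a(y := unit_lop p q)) (S - {y}) = stdp a (S - {y})" for p q
      using remove.hyps by (intro stdp_cong) auto
    have "entry (a y * stdp a (S - {y})) z w = (\<Sum>q\<in>I. entry (a y) z q * entry (stdp a (S - {y})) q w)"
      using remove.prems by (intro entry_mult a)
    also have "\<dots> = (\<Sum>p\<in>I. if p = z then \<Sum>q\<in>I. entry (a y) p q * entry (stdp a (S - {y})) q w else 0)"
      using remove.prems I by simp
    also have "\<dots> = (\<Sum>p\<in>I. \<Sum>q\<in>I. entry (a y) p q * entry (unit_lop p q * stdp a (S - {y})) z w)"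
      by (intro sum.cong refl) (auto simp: entry_unit_mult)
    finally show ?thesis
      unfolding True by (simp add: cong sum_distrib_left mult.left_commute)
  next
    case False
    have "entry (a x * stdp a (S - {x})) z w
      = (\<Sum>r\<in>I. \<Sum>p\<in>I. \<Sum>q\<in>I. entry (a y) p q * (entry (a x) z r * entry (stdp (a(y := unit_lop p q)) (S - {x})) r w))"
      using remove.prems x False by (simp add: entry_mult[OF a] remove.IH sum_distrib_left mult.left_commute fun_upd_def)
    also have "\<dots> = (\<Sum>p\<in>I. \<Sum>r\<in>I. \<Sum>q\<in>I. entry (a y) p q * (entry (a x) z r * entry (stdp (a(y := unit_lop p q)) (S - {x})) r w))"
      by (rule sum.swap)
    also have "\<dots> = (\<Sum>p\<in>I. \<Sum>q\<in>I. \<Sum>r\<in>I. entry (a y) p q * (entry (a x) z r * entry (stdp (a(y := unit_lop p q)) (S - {x})) r w))"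
      by (intro sum.cong refl sum.swap)
    also have "\<dots> = (\<Sum>p\<in>I. \<Sum>q\<in>I. entry (a y) p q * entry ((a(y := unit_lop p q)) x * stdp (a(y := unit_lop p q)) (S - {x})) z w)"
      using remove.prems False by (simp add: entry_mult[OF a] sum_distrib_left)
    finally show ?thesis by (simp add: sum_distrib_left mult.left_commute)
  qed
  then have "entry (stdp a S) z w = (\<Sum>x\<in>S. \<Sum>p\<in>I. \<Sum>q\<in>I. entry (a y) p q * (of_int (shuffle_sign {x} (S - {x}))
         * entry ((a(y := unit_lop p q)) x * stdp (a(y := unit_lop p q)) (S - {x})) z w))"
    unfolding stdp_rec[OF remove.hyps(1) ne] entry_simps mult.assoc by (intro sum.cong refl)
  also have "\<dots> = (\<Sum>p\<in>I. \<Sum>x\<in>S. \<Sum>q\<in>I. entry (a y) p q * (of_int (shuffle_sign {x} (S - {x}))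
         * entry ((a(y := unit_lop p q)) x * stdp (a(y := unit_lop p q)) (S - {x})) z w))"
    by (rule sum.swap)
  also have "\<dots> = (\<Sum>p\<in>I. \<Sum>q\<in>I. \<Sum>x\<in>S. entry (a y) p q * (of_int (shuffle_sign {x} (S - {x}))
         * entry ((a(y := unit_lop p q)) x * stdp (a(y := unit_lop p q)) (S - {x})) z w))"
    by (intro sum.cong refl sum.swap)
  also have "\<dots> = (\<Sum>p\<in>I. \<Sum>q\<in>I. entry (a y) p q * entry (stdp (a(y := unit_lop p q)) S) z w)"
    unfolding stdp_rec[OF remove.hyps(1) ne] entry_simps mult.assoc sum_distrib_left ..
  finally show ?case .
qed simp

theorem amitsur_levitzki:
  fixes a :: "nat \<Rightarrow> ('i, 'c::comm_ring_1) lop"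
  assumes I: "finite I" and a: "\<And>x. local_on I (a x)"
    and S: "finite S" "card S = 2 * card I" and zw: "z \<in> I" "w \<in> I"
  shows "entry (stdp a S) z w = 0"
proof -
  \<comment> \<open>\<open>F\<close> holds the arguments that may still be arbitrary. The induction
    trades them one by one for matrix units, until the integer case applies.\<close>
  have "entry (stdp a S) z w = 0"
    if "F \<subseteq> S" "\<And>x. local_on I (a x)" "\<And>x. x \<in> S - F \<Longrightarrow> \<exists>p q. p \<in> I \<and> q \<in> I \<and> a x = unit_lop p q"
    for F and a :: "nat \<Rightarrow> ('i, 'c) lop"
    using finite_subset[OF that(1) S(1)] that
  proof (induction F arbitrary: a rule: finite_induct)
    case empty
    then have "\<exists>p q. p \<in> I \<and> q \<in> I \<and> (x \<in> S \<longrightarrow> a x = unit_lop p q)" for x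
      using zw by blast
    then obtain p q where pq: "\<And>x. p x \<in> I" "\<And>x. q x \<in> I" "\<And>x. x \<in> S \<Longrightarrow> a x = unit_lop (p x) (q x)"
      by metis
    have "stdp a S = stdp (\<lambda>x. unit_lop (p x) (q x)) S"
      by (intro stdp_cong S(1) pq(3))
    also have "entry \<dots> z w = (of_int (entry (stdp (\<lambda>x. unit_lop (p x) (q x)) S) z w) :: 'c)"
      by (rule entry_stdp_unit[OF S(1)])
    also have "entry (stdp (\<lambda>x. unit_lop (p x) (q x) :: ('i, int) lop) S) z w = 0"
      by (intro amitsur_levitzki_int[OF I _ S zw] local_on_unit I pq)
    finally show ?case by simp
  next
    case (insert y F)
    have "entry (stdp (a(y := unit_lop p q)) S) z w = 0" if "p \<in> I" "q \<in> I" for p q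
      using insert.prems that by (intro insert.IH) (auto simp: local_on_unit I)
    then show ?case
      using insert.prems by (subst entry_stdp_expand[where I = I and y = y]) (auto simp: I S zw)
  qed
  from this[of S a] a show ?thesis by simp
qed

text \<open>Orbits may be smaller than the group, for instance at \<open>x = y = 0\<close>, so an
  identity of one fixed degree has to serve all smaller blocks too. The Laplace expansion splits off
  standard polynomials of the exact degree \<open>2 * card I\<close>.\<close>

corollary amitsur_levitzki_le:
  fixes a :: "nat \<Rightarrow> ('i, 'c::comm_ring_1) lop"
  assumes I: "finite I" and a: "\<And>x. local_on I (a x)"
    and S: "finite S" "card S \<ge> 2 * card I" and zw: "z \<in> I" "w \<in> I"
  shows "entry (stdp a S) z w = 0"
proof -
  have "entry (stdp a S) z w = (\<Sum>T | T \<subseteq> S \<and> card T = 2 * card I.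
      of_int (shuffle_sign T (S - T)) * entry (stdp a T * stdp a (S - T)) z w)"
    using S by (subst stdp_laplace[of S "2 * card I"]) (simp_all add: entry_simps mult.assoc)
  also have "\<dots> = 0"
  proof (intro sum.neutral ballI)
    fix T assume "T \<in> {T. T \<subseteq> S \<and> card T = 2 * card I}"
    then have "entry (stdp a T) z y = 0" if "y \<in> I" for y
      using that zw S finite_subset by (intro amitsur_levitzki[OF I a]) auto
    then show "of_int (shuffle_sign T (S - T)) * entry (stdp a T * stdp a (S - T)) z w = 0"
      using zw by (simp add: entry_mult[OF local_on_stdp[OF I a]])
  qed
  finally show ?thesis .
qed

section \<open>Evaluation of noncommutative polynomials\<close>

lemma poly_mapping_single_sum:
  fixes f :: "'a \<Rightarrow>\<^sub>0 'b::comm_monoid_add"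
  shows "f = (\<Sum>w\<in>Poly_Mapping.keys f. Poly_Mapping.single w (Poly_Mapping.lookup f w))"
  by (rule poly_mapping_eqI) (simp add: lookup_sum lookup_single when_def in_keys_iff)

lemma free_const_commute:
  fixes f :: "('x, 'k::field) free_alg"
  shows "free_const c * f = f * free_const c"
proof -
  have "free_const c * Poly_Mapping.single w d = Poly_Mapping.single w d * free_const c" for w :: "'x word" and d
    by (simp add: free_const_def mult_single mult.commute)
  then show ?thesis
    by (subst (1 2) poly_mapping_single_sum[of f]) (simp add: sum_distrib_left sum_distrib_right)
qed

lemma free_const_simps:
  "free_const (c + d) = free_const c + free_const d" "free_const (c * d) = free_const c * free_const d"
  "free_const 0 = 0" "free_const 1 = 1"
  by (simp_all add: free_const_def single_add mult_single single_one)

text \<open>A ring with a central copy of the field. One evaluation map then covers both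
  substitution inside free algebras (\<open>fs\<close>) and representation by operators
  (\<open>ls\<close>).\<close>

locale scalars =
  fixes sc :: "'k::field \<Rightarrow> 'r::ring_1"
  assumes sc_add: "sc (c + d) = sc c + sc d" and sc_mult: "sc (c * d) = sc c * sc d"
    and sc_0: "sc 0 = 0" and sc_1: "sc 1 = 1" and sc_commute: "sc c * r = r * sc c"
begin

definition free_eval :: "('x \<Rightarrow> 'r) \<Rightarrow> ('x, 'k) free_alg \<Rightarrow> 'r" where
  "free_eval e f = (\<Sum>w\<in>Poly_Mapping.keys f. sc (Poly_Mapping.lookup f w) * prod_list (map e (letters w)))"

lemma free_eval_superset:
  "finite A \<Longrightarrow> Poly_Mapping.keys f \<subseteq> A \<Longrightarrow>
    free_eval e f = (\<Sum>w\<in>A. sc (Poly_Mapping.lookup f w) * prod_list (map e (letters w)))"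
  unfolding free_eval_def by (intro sum.mono_neutral_left) (auto simp: in_keys_iff sc_0)

lemma free_eval_add: "free_eval e (f + g) = free_eval e f + free_eval e g"
proof -
  let ?A = "Poly_Mapping.keys f \<union> Poly_Mapping.keys g"
  have "Poly_Mapping.keys (f + g) \<subseteq> ?A" by (rule keys_add)
  then show ?thesis
    using free_eval_superset[of ?A]
    by (simp add: lookup_add sc_add distrib_right sum.distrib)
qed

lemma free_eval_0 [simp]: "free_eval e 0 = 0"
  by (simp add: free_eval_def)

lemma free_eval_sum: "free_eval e (sum f A) = (\<Sum>x\<in>A. free_eval e (f x))"
  by (induction A rule: infinite_finite_induct) (simp_all add: free_eval_add)

lemma free_eval_single: "free_eval e (Poly_Mapping.single w c) = sc c * prod_list (map e (letters w))"
  by (cases "c = 0") (simp_all add: free_eval_def sc_0)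

lemma free_eval_mult: "free_eval e (f * g) = free_eval e f * free_eval e g"
proof -
  have single: "free_eval e (Poly_Mapping.single v c * Poly_Mapping.single w d)
      = free_eval e (Poly_Mapping.single v c) * free_eval e (Poly_Mapping.single w d)" for v w c d
    using sc_commute[of d "prod_list (map e (letters v))"]
    by (simp add: mult_single free_eval_single plus_word_def sc_mult mult.assoc) (metis mult.assoc)
  show ?thesis
    by (subst (1 2) poly_mapping_single_sum[of f], subst (1 2) poly_mapping_single_sum[of g])
      (simp add: sum_distrib_left sum_distrib_right free_eval_sum single)
qed

lemma free_eval_var [simp]: "free_eval e (free_var x) = e x"
  by (simp add: free_var_def free_eval_single sc_1)

lemma free_eval_const [simp]: "free_eval e (free_const c) = sc c"
  by (simp add: free_const_def free_eval_single zero_word_def)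

lemma free_eval_1 [simp]: "free_eval e 1 = 1"
  using free_eval_const[of e 1] by (simp add: free_const_simps sc_1)

lemma free_eval_uminus: "free_eval e (- f) = - free_eval e f"
  using free_eval_add[of e "- f" f] by (simp add: eq_neg_iff_add_eq_0)

lemma free_eval_diff: "free_eval e (f - g) = free_eval e f - free_eval e g"
  using free_eval_add[of e f "- g"] by (simp add: free_eval_uminus)

lemma free_eval_power: "free_eval e (f ^ n) = free_eval e f ^ n"
  by (induction n) (simp_all add: free_eval_mult)

lemma free_eval_of_int: "free_eval e (of_int k) = of_int k"
proof -
  have "free_eval e (of_nat n) = of_nat n" for n
    by (induction n) (simp_all add: free_eval_add)
  then show ?thesis by (cases k rule: int_cases2) (simp_all add: free_eval_uminus)
qed

lemma free_eval_prod_list: "free_eval e (prod_list fs) = prod_list (map (free_eval e) fs)"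
  by (induction fs) (simp_all add: free_eval_mult)

lemma free_eval_stdp: "free_eval e (stdp a S) = stdp (\<lambda>x. free_eval e (a x)) S"
proof (cases "finite S")
  case True
  then show ?thesis
  proof (induction S rule: finite_remove_induct')
    case (remove S)
    then show ?case
      by (simp add: stdp_rec[OF remove.hyps] free_eval_sum free_eval_mult free_eval_of_int)
  qed simp
qed (simp add: stdp.simps)

end

interpretation fs: scalars "free_const :: 'k::field \<Rightarrow> ('x, 'k) free_alg"
  by unfold_locales (simp_all only: free_const_simps, rule free_const_commute)

lemma (in scalars) free_eval_subst:
  "free_eval e (fs.free_eval g F) = free_eval (\<lambda>i. free_eval e (g i)) F"
  unfolding fs.free_eval_def[of g F] free_eval_sum free_eval_mult free_eval_prod_list
    free_eval_const map_map comp_def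
  by (rule free_eval_def[symmetric])

section \<open>The free algebra and its quotients\<close>

lemma free_algebra_simps [simp]:
  "carrier free_algebra = UNIV" "x \<otimes>\<^bsub>free_algebra\<^esub> y = x * y" "\<one>\<^bsub>free_algebra\<^esub> = 1"
  "x \<oplus>\<^bsub>free_algebra\<^esub> y = x + y" "\<zero>\<^bsub>free_algebra\<^esub> = 0" "c \<odot>\<^bsub>free_algebra\<^esub> x = free_const c * x"
  by (simp_all add: free_algebra_def ring_of_type_algebra_def ring.defs module.defs)

lemma ring_free_algebra: "ring (free_algebra :: ('k::field, ('x, 'k) free_alg) module)"
proof (rule ringI)
  show "abelian_group (free_algebra :: ('k, ('x, 'k) free_alg) module)"
    by (rule abelian_groupI) (auto simp: add.assoc add.commute intro: exI[of _ "- x" for x])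
  show "Group.monoid (free_algebra :: ('k, ('x, 'k) free_alg) module)"
    by (rule monoidI) (auto simp: mult.assoc)
qed (auto simp: algebra_simps)

locale free_ideal =
  fixes I :: "('x, 'k::field) free_alg set"
  assumes ideal: "ideal I free_algebra"
begin

lemma zero: "0 \<in> I"
  using additive_subgroup.zero_closed[OF ideal.axioms(1)[OF ideal]] by simp

lemma add: "x \<in> I \<Longrightarrow> y \<in> I \<Longrightarrow> x + y \<in> I"
  using additive_subgroup.a_closed[OF ideal.axioms(1)[OF ideal], of x y] by simp

lemma mult_left: "x \<in> I \<Longrightarrow> r * x \<in> I"
  using ideal.I_l_closed[OF ideal, of x r] by simp

lemma mult_right: "x \<in> I \<Longrightarrow> x * r \<in> I"
  using ideal.I_r_closed[OF ideal, of x r] by simp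

lemma uminus: "x \<in> I \<Longrightarrow> - x \<in> I"
  using mult_left[of x "- 1"] by simp

lemma diff: "x \<in> I \<Longrightarrow> y \<in> I \<Longrightarrow> x - y \<in> I"
  using add[of x "- y"] uminus by simp

abbreviation Q where "Q \<equiv> quot_algebra free_algebra I"
abbreviation cls where "cls x \<equiv> I +>\<^bsub>free_algebra\<^esub> x"

lemma cls_def: "cls x = {i + x | i. i \<in> I}"
  by (auto simp: a_r_coset_def')

lemma cls_eq_iff: "cls x = cls y \<longleftrightarrow> x - y \<in> I"
proof
  assume "cls x = cls y"
  then have "x \<in> cls y" unfolding cls_def[of x, symmetric] using zero by (auto simp: cls_def)
  then show "x - y \<in> I" by (auto simp: cls_def)
next
  assume xy: "x - y \<in> I"
  show "cls x = cls y"
  proof (intro equalityI subsetI)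
    fix z assume "z \<in> cls x"
    then have "z - x \<in> I" by (auto simp: cls_def)
    from add[OF this xy] show "z \<in> cls y" by (auto simp: cls_def intro!: exI[of _ "z - y"])
  next
    fix z assume "z \<in> cls y"
    then have "z - y \<in> I" by (auto simp: cls_def)
    from diff[OF this xy] show "z \<in> cls x" by (auto simp: cls_def intro!: exI[of _ "z - x"])
  qed
qed

lemma cls_0: "cls 0 = I"
  by (simp add: cls_def)

lemma Q_simps:
  "carrier Q = range cls" "\<one>\<^bsub>Q\<^esub> = cls 1" "\<zero>\<^bsub>Q\<^esub> = cls 0"
  "cls x \<otimes>\<^bsub>Q\<^esub> cls y = cls (x * y)" "cls x \<oplus>\<^bsub>Q\<^esub> cls y = cls (x + y)"
  "c \<odot>\<^bsub>Q\<^esub> cls x = cls (free_const c * x)"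
proof -
  show "carrier Q = range cls"
    by (simp add: quot_algebra_def ring.defs module.defs FactRing_def A_RCOSETS_def' UNION_singleton_eq_range)
  show "\<one>\<^bsub>Q\<^esub> = cls 1" "\<zero>\<^bsub>Q\<^esub> = cls 0"
    by (simp_all add: quot_algebra_def ring.defs module.defs FactRing_def cls_0)
  show "cls x \<otimes>\<^bsub>Q\<^esub> cls y = cls (x * y)"
    using ideal.rcoset_mult_add[OF ideal, of x y] by (simp add: quot_algebra_def ring.defs module.defs FactRing_def)
  show "cls x \<oplus>\<^bsub>Q\<^esub> cls y = cls (x + y)"
    using abelian_subgroup.a_rcos_sum[OF abelian_subgroupI3[OF ideal.axioms(1)[OF ideal] ring.is_abelian_group[OF ring_free_algebra]], of x y] by (simp add: quot_algebra_def ring.defs module.defs FactRing_def)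
  \<comment> \<open>The scalar action on a coset is a union over its representatives; all of them
    yield the same coset.\<close>
  have eq: "cls (free_const c * y) = cls (free_const c * x)" if "y \<in> cls x" for y
  proof -
    have "y - x \<in> I" using that by (auto simp: cls_def)
    then show ?thesis by (simp add: cls_eq_iff mult_left flip: right_diff_distrib)
  qed
  have "x \<in> cls x" using zero by (auto simp: cls_def)
  then have "(\<Union>y\<in>cls x. cls (free_const c * y)) = cls (free_const c * x)"
    by (intro SUP_eq_const eq) auto
  then show "c \<odot>\<^bsub>Q\<^esub> cls x = cls (free_const c * x)"
    by (simp add: quot_algebra_def ring.defs module.defs FactRing_def)
qed

lemma abelian_monoid_Q: "abelian_monoid Q"
  by (rule abelian_monoidI) (auto simp: Q_simps ac_simps)

lemma finsum_Q: "finsum Q (\<lambda>w. cls (f w)) A = cls (sum f A)"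
proof -
  interpret Q: abelian_monoid Q by (rule abelian_monoid_Q)
  show ?thesis
    by (induction A rule: infinite_finite_induct) (auto simp: Q_simps Q.finsum_insert Q.finsum_infinite)
qed

lemma nc_eval_Q: "nc_eval Q (\<lambda>i. cls (g i)) F = cls (fs.free_eval g F)"
proof -
  have "foldr (\<lambda>x r. cls (g x) \<otimes>\<^bsub>Q\<^esub> r) xs \<one>\<^bsub>Q\<^esub> = cls (prod_list (map g xs))" for xs
    by (induction xs) (simp_all add: Q_simps)
  then show ?thesis
    by (simp add: nc_eval_def word_eval_def Q_simps finsum_Q fs.free_eval_def)
qed

text \<open>Every assignment into the quotient lifts to the free algebra, so identities can be
  tested there modulo \<open>I\<close>, without cosets.\<close>

lemma poly_identity_Q: "poly_identity Q F \<longleftrightarrow> (\<forall>g. fs.free_eval g F \<in> I)"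
proof -
  have "poly_identity Q F \<longleftrightarrow> (\<forall>g. nc_eval Q (\<lambda>i. cls (g i)) F = \<zero>\<^bsub>Q\<^esub>)"
  proof
    assume r: "\<forall>g. nc_eval Q (\<lambda>i. cls (g i)) F = \<zero>\<^bsub>Q\<^esub>"
    show "poly_identity Q F"
      unfolding poly_identity_def
    proof (intro allI impI)
      fix a :: "nat \<Rightarrow> _" assume "\<forall>i. a i \<in> carrier Q"
      then have "\<forall>i. \<exists>x. a i = cls x" by (auto simp: Q_simps)
      from choice[OF this] obtain g where "\<And>i. a i = cls (g i)" by blast
      then have "a = (\<lambda>i. cls (g i))" by (rule ext)
      with r show "nc_eval Q a F = \<zero>\<^bsub>Q\<^esub>" by simp
    qed
  qed (simp add: poly_identity_def Q_simps)
  then show ?thesis by (simp add: nc_eval_Q Q_simps(3) cls_eq_iff)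
qed

end

section \<open>A faithful representation\<close>

interpretation ls: scalars "scal :: 'k::field \<Rightarrow> ('i, 'k) lop"
  by unfold_locales (simp_all only: scal_add scal_mult scal_0 scal_1, rule scal_commute)

text \<open>
  \<open>X11\<close> and the quantum determinant \<open>X11 X22 - \<alpha>\<inverse> X12 X21\<close> act as multiplication by \<open>x\<close> and
  \<open>x y\<close>, while \<open>X12\<close> and \<open>X21\<close> shift their joint eigenvalues; \<open>p\<close> and \<open>q\<close> are free parameters.
  The factors \<open>x\<close> make the relations hold also at \<open>x = 0\<close>.
\<close>

lift_definition qop :: "'k::field \<Rightarrow> 'k \<Rightarrow> mat_gen \<Rightarrow> ('k \<times> 'k \<times> 'k \<times> 'k, 'k) lop" is
  "\<lambda>\<alpha> \<beta> g v (x, y, p, q). case g of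
     X11 \<Rightarrow> x * v (x, y, p, q)
   | X12 \<Rightarrow> p * x * v (\<alpha> * x, y / \<beta>, p, q)
   | X21 \<Rightarrow> q * x * v (\<beta> * x, y / \<alpha>, p, q)
   | X22 \<Rightarrow> y * v (x, y, p, q) + p * q * x * v (\<alpha> * \<beta> * x, y / (\<alpha> * \<beta>), p, q)"
  by (auto simp: fun_eq_iff algebra_simps split: mat_gen.split)

lemma app_qop:
  "app (qop \<alpha> \<beta> X11) v (x, y, p, q) = x * v (x, y, p, q)"
  "app (qop \<alpha> \<beta> X12) v (x, y, p, q) = p * x * v (\<alpha> * x, y / \<beta>, p, q)"
  "app (qop \<alpha> \<beta> X21) v (x, y, p, q) = q * x * v (\<beta> * x, y / \<alpha>, p, q)"
  "app (qop \<alpha> \<beta> X22) v (x, y, p, q) = y * v (x, y, p, q) + p * q * x * v (\<alpha> * \<beta> * x, y / (\<alpha> * \<beta>), p, q)"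
  by (simp_all add: qop.rep_eq)

locale qmat =
  fixes \<alpha> \<beta> :: "'k::field"
  assumes nz: "\<alpha> \<noteq> 0" "\<beta> \<noteq> 0"
begin

definition rep :: "(mat_gen, 'k) free_alg \<Rightarrow> ('k \<times> 'k \<times> 'k \<times> 'k, 'k) lop" where
  "rep = ls.free_eval (qop \<alpha> \<beta>)"

lemma rep_simps:
  "rep (f + g) = rep f + rep g" "rep (f * g) = rep f * rep g" "rep (f - g) = rep f - rep g"
  "rep 0 = 0" "rep 1 = 1" "rep (free_const c) = scal c" "rep (free_var x) = qop \<alpha> \<beta> x"
  "rep (f ^ n) = rep f ^ n" "rep (sum h A) = (\<Sum>x\<in>A. rep (h x))"
  by (simp_all add: rep_def ls.free_eval_add ls.free_eval_mult ls.free_eval_diff ls.free_eval_power ls.free_eval_sum)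

abbreviation "I \<equiv> Idl\<^bsub>free_algebra\<^esub> (qmat_relators \<alpha> \<beta>)"

lemma rep_relators:
  assumes "r \<in> qmat_relators \<alpha> \<beta>"
  shows "rep r = 0"
proof (rule lop_eqI)
  fix v :: "'k \<times> 'k \<times> 'k \<times> 'k \<Rightarrow> 'k" and z :: "'k \<times> 'k \<times> 'k \<times> 'k"
  obtain x y p q where z: "z = (x, y, p, q)" by (cases z)
  show "app (rep r) v z = app 0 v z"
    using assms nz unfolding qmat_relators_def Let_def z
    by (auto simp: rep_simps app_simps app_qop scal.rep_eq) (simp_all add: mult.commute mult.left_commute distrib_left distrib_right left_diff_distrib, simp add: field_simps)
qed

sublocale free_ideal I
  by (rule free_ideal.intro, rule ring.genideal_ideal[OF ring_free_algebra]) simp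

lemma relators_in: "r \<in> qmat_relators \<alpha> \<beta> \<Longrightarrow> r \<in> I"
  using ring.genideal_self[OF ring_free_algebra, of "qmat_relators \<alpha> \<beta>"] by auto

lemma rep_ideal:
  assumes "f \<in> I"
  shows "rep f = 0"
proof -
  have neg: "rep (- f) = - rep f" for f
    using rep_simps(3)[of 0 f] by (simp add: rep_simps)
  have "ideal {f. rep f = 0} (free_algebra :: ('k, (mat_gen, 'k) free_alg) module)"
  proof (rule idealI)
    show "ring (free_algebra :: ('k, (mat_gen, 'k) free_alg) module)" by (rule ring_free_algebra)
    note group = abelian_group.a_group[OF ring.is_abelian_group[OF ring_free_algebra]]
    have "inv\<^bsub>add_monoid free_algebra\<^esub> f = - f" for f :: "(mat_gen, 'k) free_alg"
      by (rule group.inv_equality[OF group]) auto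
    then show "subgroup {f. rep f = 0} (add_monoid (free_algebra :: ('k, (mat_gen, 'k) free_alg) module))"
      by (intro group.subgroupI[OF group]) (auto simp: rep_simps neg intro: exI[of _ 0])
  qed (simp_all add: rep_simps)
  from ring.genideal_minimal[OF ring_free_algebra this] rep_relators
  have "I \<subseteq> {f. rep f = 0}" by blast
  with assms show ?thesis by blast
qed

section \<open>Ordered monomials span the algebra\<close>

definition cong (infix \<open>\<approx>\<close> 50) where "f \<approx> g \<longleftrightarrow> f - g \<in> I"

lemma cong_mult_right: "f \<approx> g \<Longrightarrow> f * h \<approx> g * h"
  using mult_right[of "f - g" h] by (simp add: cong_def left_diff_distrib)

lemma relations:
  "free_var X12 * free_var X11 \<approx> free_const \<alpha> * free_var X11 * free_var X12"
  "free_var X22 * free_var X21 \<approx> free_const \<alpha> * free_var X21 * free_var X22"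
  "free_var X21 * free_var X11 \<approx> free_const \<beta> * free_var X11 * free_var X21"
  "free_var X22 * free_var X12 \<approx> free_const \<beta> * free_var X12 * free_var X22"
  "free_var X21 * free_var X12 \<approx> free_const (\<beta> * inverse \<alpha>) * free_var X12 * free_var X21"
  "free_var X22 * free_var X11 \<approx> free_var X11 * free_var X22
     + free_const (\<beta> - inverse \<alpha>) * free_var X12 * free_var X21"
  unfolding cong_def by (rule relators_in, simp add: qmat_relators_def Let_def diff_diff_eq)+

definition nmon :: "nat \<times> nat \<times> nat \<times> nat \<Rightarrow> (mat_gen, 'k) free_alg" where
  "nmon = (\<lambda>(a, b, c, d). free_var X11 ^ a * free_var X12 ^ b * free_var X21 ^ c * free_var X22 ^ d)"

text \<open>The linear span of the ordered monomials modulo \<open>I\<close>, given inductively so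
  that one term is handled at a time.\<close>

inductive_set nspan :: "(mat_gen, 'k) free_alg set" where
  base: "f \<in> I \<Longrightarrow> f \<in> nspan"
| step: "f \<in> nspan \<Longrightarrow> free_const c * nmon e + f \<in> nspan"

lemma nspan_add: "f \<in> nspan \<Longrightarrow> g \<in> nspan \<Longrightarrow> f + g \<in> nspan"
proof (induction f rule: nspan.induct)
  case (base f)
  from base(2,1) show ?case
  proof (induction g rule: nspan.induct)
    case (base g)
    then show ?case by (intro nspan.base add)
  next
    case (step g c e)
    from nspan.step[OF step.IH[OF step.prems], of c e] show ?case by (simp add: ac_simps)
  qed
next
  case (step f c e)
  from nspan.step[OF step.IH[OF step.prems], of c e] show ?case by (simp add: ac_simps)
qed

lemma nspan_const: "f \<in> nspan \<Longrightarrow> free_const c * f \<in> nspan"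
proof (induction f rule: nspan.induct)
  case (base f)
  then show ?case by (intro nspan.base mult_left)
next
  case (step f d e)
  from nspan.step[OF step.IH, of "c * d" e] show ?case
    by (simp add: distrib_left free_const_simps mult.assoc)
qed

lemma nspan_nmon: "nmon e \<in> nspan"
  using nspan.step[OF nspan.base[OF zero], of 1 e] by (simp add: free_const_simps)

lemma nspan_cong: "f \<approx> g \<Longrightarrow> g \<in> nspan \<Longrightarrow> f \<in> nspan"
  using nspan_add[OF nspan.base, of "f - g" g] by (simp add: cong_def)

lemma nspan_left:
  assumes "\<And>e. u * nmon e \<in> nspan" and "f \<in> nspan"
  shows "u * f \<in> nspan"
  using assms(2)
proof (induction f rule: nspan.induct)
  case (base f)
  then show ?case by (intro nspan.base mult_left)
next
  case (step f c e)
  have "u * (free_const c * nmon e + f) = free_const c * (u * nmon e) + u * f"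
    by (simp add: distrib_left free_const_commute[of c u] flip: mult.assoc)
  with step.IH assms(1) show ?case by (simp add: nspan_add nspan_const)
qed

lemma nspan_X11: "f \<in> nspan \<Longrightarrow> free_var X11 * f \<in> nspan"
proof (rule nspan_left)
  fix e :: "nat \<times> nat \<times> nat \<times> nat"
  obtain a b c d where e: "e = (a, b, c, d)" by (cases e)
  have "free_var X11 * nmon e = nmon (Suc a, b, c, d)" by (simp add: e nmon_def mult.assoc)
  then show "free_var X11 * nmon e \<in> nspan" by (simp add: nspan_nmon)
qed

text \<open>The common reordering step. The generators are treated in the order in which they occur
  in \<open>nmon\<close>, so when \<open>u\<close> has to pass an earlier generator
  \<open>v\<close>, left multiplication by \<open>v\<close> is already known to preserve the
  span.\<close>

lemma nspan_commute:
  assumes rel: "u * v \<approx> free_const c * v * u" and "\<And>f. f \<in> nspan \<Longrightarrow> v * f \<in> nspan"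
    and "u * f \<in> nspan"
  shows "u * (v * f) \<in> nspan"
proof (rule nspan_cong)
  show "u * (v * f) \<approx> free_const c * (v * (u * f))"
    using cong_mult_right[OF rel, of f] by (simp add: mult.assoc)
  show "free_const c * (v * (u * f)) \<in> nspan" using assms by (intro nspan_const)
qed

lemma nspan_X12: "f \<in> nspan \<Longrightarrow> free_var X12 * f \<in> nspan"
proof (rule nspan_left)
  fix e :: "nat \<times> nat \<times> nat \<times> nat"
  obtain a b c d where e: "e = (a, b, c, d)" by (cases e)
  have "free_var X12 * nmon (a, b, c, d) \<in> nspan"
  proof (induction a)
    case 0
    have "free_var X12 * nmon (0, b, c, d) = nmon (0, Suc b, c, d)" by (simp add: nmon_def mult.assoc)
    then show ?case by (simp add: nspan_nmon)
  next
    case (Suc a)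
    have "nmon (Suc a, b, c, d) = free_var X11 * nmon (a, b, c, d)" by (simp add: nmon_def mult.assoc)
    with Suc show ?case by (simp only: nspan_commute[OF relations(1) nspan_X11])
  qed
  then show "free_var X12 * nmon e \<in> nspan" by (simp add: e)
qed

lemma nspan_X21: "f \<in> nspan \<Longrightarrow> free_var X21 * f \<in> nspan"
proof (rule nspan_left)
  fix e :: "nat \<times> nat \<times> nat \<times> nat"
  obtain a b c d where e: "e = (a, b, c, d)" by (cases e)
  have "free_var X21 * nmon (0, b, c, d) \<in> nspan"
  proof (induction b)
    case 0
    have "free_var X21 * nmon (0, 0, c, d) = nmon (0, 0, Suc c, d)" by (simp add: nmon_def mult.assoc)
    then show ?case by (simp add: nspan_nmon)
  next
    case (Suc b)
    have "nmon (0, Suc b, c, d) = free_var X12 * nmon (0, b, c, d)" by (simp add: nmon_def mult.assoc)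
    with Suc show ?case by (simp only: nspan_commute[OF relations(5) nspan_X12])
  qed
  then have "free_var X21 * nmon (a, b, c, d) \<in> nspan"
  proof (induction a)
    case (Suc a)
    have "nmon (Suc a, b, c, d) = free_var X11 * nmon (a, b, c, d)" by (simp add: nmon_def mult.assoc)
    with Suc show ?case by (simp only: nspan_commute[OF relations(3) nspan_X11])
  qed
  then show "free_var X21 * nmon e \<in> nspan" by (simp add: e)
qed

lemma nspan_X22: "f \<in> nspan \<Longrightarrow> free_var X22 * f \<in> nspan"
proof (rule nspan_left)
  fix e :: "nat \<times> nat \<times> nat \<times> nat"
  obtain a b c d where e: "e = (a, b, c, d)" by (cases e)
  have "free_var X22 * nmon (0, 0, c, d) \<in> nspan"
  proof (induction c)
    case 0
    have "free_var X22 * nmon (0, 0, 0, d) = nmon (0, 0, 0, Suc d)" by (simp add: nmon_def mult.assoc)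
    then show ?case by (simp add: nspan_nmon)
  next
    case (Suc c)
    have "nmon (0, 0, Suc c, d) = free_var X21 * nmon (0, 0, c, d)" by (simp add: nmon_def mult.assoc)
    with Suc show ?case by (simp only: nspan_commute[OF relations(2) nspan_X21])
  qed
  then have "free_var X22 * nmon (0, b, c, d) \<in> nspan"
  proof (induction b)
    case (Suc b)
    have "nmon (0, Suc b, c, d) = free_var X12 * nmon (0, b, c, d)" by (simp add: nmon_def mult.assoc)
    with Suc show ?case by (simp only: nspan_commute[OF relations(4) nspan_X12])
  qed
  then have "free_var X22 * nmon (a, b, c, d) \<in> nspan"
  proof (induction a)
    case (Suc a)
    let ?m = "nmon (a, b, c, d)"
    have "nmon (Suc a, b, c, d) = free_var X11 * ?m" by (simp add: nmon_def mult.assoc)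
    \<comment> \<open>The only relation with an additional term; that term starts with generators
      settled before.\<close>
    moreover have "free_var X22 * (free_var X11 * ?m) \<in> nspan"
    proof (rule nspan_cong)
      show "free_var X22 * (free_var X11 * ?m) \<approx> free_var X11 * (free_var X22 * ?m)
          + free_const (\<beta> - inverse \<alpha>) * (free_var X12 * (free_var X21 * ?m))"
        using cong_mult_right[OF relations(6), of ?m] by (simp add: mult.assoc distrib_right)
      show "free_var X11 * (free_var X22 * ?m)
          + free_const (\<beta> - inverse \<alpha>) * (free_var X12 * (free_var X21 * ?m)) \<in> nspan"
        using Suc by (intro nspan_add nspan_const nspan_X11 nspan_X12 nspan_X21 nspan_nmon)
    qed
    ultimately show ?case by simp
  qed
  then show "free_var X22 * nmon e \<in> nspan" by (simp add: e)
qed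

lemma nspan_UNIV: "f \<in> nspan"
proof -
  have word: "Poly_Mapping.single (Word xs) 1 \<in> nspan" for xs
  proof (induction xs)
    case Nil
    have "Poly_Mapping.single (Word []) 1 = nmon (0, 0, 0, 0)"
      by (simp add: nmon_def single_one flip: zero_word_def)
    then show ?case by (simp add: nspan_nmon)
  next
    case (Cons x xs)
    have "Poly_Mapping.single (Word (x # xs)) 1 = free_var x * Poly_Mapping.single (Word xs) (1 :: 'k)"
      by (simp add: free_var_def mult_single plus_word_def)
    with Cons show ?case
      by (cases x) (simp_all add: nspan_X11 nspan_X12 nspan_X21 nspan_X22)
  qed
  have single: "Poly_Mapping.single w c \<in> nspan" for w c
    using nspan_const[OF word[of "letters w"], of c] by (simp add: free_const_def mult_single)
  have "(\<Sum>w\<in>A. Poly_Mapping.single w (h w)) \<in> nspan" for A h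
    by (induction A rule: infinite_finite_induct) (simp_all add: nspan_add single nspan.base zero)
  then show ?thesis by (subst poly_mapping_single_sum)
qed

lemma nspan_expand:
  assumes "f \<in> nspan"
  shows "\<exists>E c. finite E \<and> f \<approx> (\<Sum>e\<in>E. free_const (c e) * nmon e)"
  using assms
proof (induction f rule: nspan.induct)
  case (base f)
  then show ?case by (intro exI[of _ "{}"]) (simp add: cong_def)
next
  case (step f k e)
  then obtain E c where E: "finite E" "f \<approx> (\<Sum>e\<in>E. free_const (c e) * nmon e)" by blast
  \<comment> \<open>If \<open>e\<close> already occurs in \<open>E\<close>, the two coefficients are
    merged.\<close>
  define c' where "c' x = (if x \<in> E then c x else 0) + (if x = e then k else 0)" for x
  have "(\<Sum>x\<in>insert e E. free_const (c' x) * nmon x)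
    = (\<Sum>x\<in>insert e E. free_const (if x \<in> E then c x else 0) * nmon x)
      + (\<Sum>x\<in>insert e E. free_const (if x = e then k else 0) * nmon x)"
    by (simp add: c'_def free_const_simps distrib_right sum.distrib del: sum.insert)
  also have "(\<Sum>x\<in>insert e E. free_const (if x \<in> E then c x else 0) * nmon x) = (\<Sum>x\<in>E. free_const (c x) * nmon x)"
    using E(1) by (intro sum.mono_neutral_cong_right) (auto simp: free_const_simps)
  also have "(\<Sum>x\<in>insert e E. free_const (if x = e then k else 0) * nmon x) = (\<Sum>x\<in>{e}. free_const k * nmon x)"
    using E(1) by (intro sum.mono_neutral_cong_right) (auto simp: free_const_simps)
  finally have "free_const k * nmon e + f \<approx> (\<Sum>x\<in>insert e E. free_const (c' x) * nmon x)"
    using E(2) by (simp add: cong_def)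
  with E(1) show ?case by (intro exI[of _ "insert e E"] exI[of _ c'] conjI finite.insertI)
qed

end

section \<open>Linear independence of the ordered monomials\<close>

text \<open>A polynomial that vanishes on an infinite field is zero. Several terms may share an
  exponent, so each coefficient is a sum over a fibre of \<open>f\<close>.\<close>

lemma sum_power_eq_0:
  fixes c :: "'e \<Rightarrow> 'k::field"
  assumes inf: "infinite (UNIV :: 'k set)" and E: "finite E"
    and eq: "\<And>x. (\<Sum>e\<in>E. c e * x ^ f e) = 0"
  shows "(\<Sum>e | e \<in> E \<and> f e = n. c e) = 0"
proof -
  define P where "P = (\<Sum>e\<in>E. monom (c e) (f e))"
  have "poly P x = 0" for x by (simp add: P_def poly_sum poly_monom eq)
  then have "P = 0" using inf poly_roots_finite[of P] by auto
  then have "coeff P n = 0" by simp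
  then have "(\<Sum>e\<in>E. if f e = n then c e else 0) = 0" by (simp add: P_def coeff_sum)
  with E show ?thesis by (simp add: sum.inter_filter)
qed

text \<open>
  The image of the constant function \<open>1\<close> under a normal monomial is a polynomial whose lowest
  term in \<open>p\<close> determines the monomial.
\<close>

definition lowest_term :: "nat \<Rightarrow> nat \<Rightarrow> nat \<Rightarrow> nat \<Rightarrow> 'k::field \<Rightarrow> ('k \<times> 'k \<times> 'k \<times> 'k \<Rightarrow> 'k) \<Rightarrow> bool" where
  "lowest_term b n m c u v \<longleftrightarrow> (\<exists>G. \<forall>x y q. (\<forall>p. v (x, y, p, q) = poly (G x y q) p)
     \<and> (\<forall>j<b. coeff (G x y q) j = 0) \<and> coeff (G x y q) b = u * x ^ n * y ^ m * q ^ c)"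

lemma lowest_termE:
  assumes "lowest_term b n m c u v"
  obtains G where "\<And>x y p q. v (x, y, p, q) = poly (G x y q) p"
    "\<And>x y q j. j < b \<Longrightarrow> coeff (G x y q) j = 0"
    "\<And>x y q. coeff (G x y q) b = u * x ^ n * y ^ m * q ^ c"
  using assms unfolding lowest_term_def by blast

lemma lowest_termI:
  assumes "\<And>x y p q. v (x, y, p, q) = poly (G x y q) p"
    "\<And>x y q j. j < b \<Longrightarrow> coeff (G x y q) j = 0"
    "\<And>x y q. coeff (G x y q) b = u * x ^ n * y ^ m * q ^ c"
  shows "lowest_term b n m c u v"
  using assms unfolding lowest_term_def by blast

context qmat
begin

lemma lowest_X11:
  assumes "lowest_term b n m c u v"
  shows "lowest_term b (Suc n) m c u (app (qop \<alpha> \<beta> X11) v)"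
  using assms
proof (rule lowest_termE)
  fix G
  assume "\<And>x y p q. v (x, y, p, q) = poly (G x y q) p"
    "\<And>x y q j. j < b \<Longrightarrow> coeff (G x y q) j = 0"
    "\<And>x y q. coeff (G x y q) b = u * x ^ n * y ^ m * q ^ c"
  then show ?thesis
    by (intro lowest_termI[where G = "\<lambda>x y q. smult x (G x y q)"]) (simp_all add: app_qop)
qed

lemma lowest_X12:
  assumes "lowest_term b n m c u v"
  shows "lowest_term (Suc b) (Suc n) m c (u * \<alpha> ^ n / \<beta> ^ m) (app (qop \<alpha> \<beta> X12) v)"
  using assms
proof (rule lowest_termE)
  fix G
  assume G: "\<And>x y p q. v (x, y, p, q) = poly (G x y q) p"
    "\<And>x y q j. j < b \<Longrightarrow> coeff (G x y q) j = 0"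
    "\<And>x y q. coeff (G x y q) b = u * x ^ n * y ^ m * q ^ c"
  then show ?thesis
    using nz by (intro lowest_termI[where G = "\<lambda>x y q. pCons 0 (smult x (G (\<alpha> * x) (y / \<beta>) q))"])
      (auto simp: app_qop coeff_pCons power_mult_distrib power_divide split: nat.split)
qed

lemma lowest_X21:
  assumes "lowest_term b n m c u v"
  shows "lowest_term b (Suc n) m (Suc c) (u * \<beta> ^ n / \<alpha> ^ m) (app (qop \<alpha> \<beta> X21) v)"
  using assms
proof (rule lowest_termE)
  fix G
  assume G: "\<And>x y p q. v (x, y, p, q) = poly (G x y q) p"
    "\<And>x y q j. j < b \<Longrightarrow> coeff (G x y q) j = 0"
    "\<And>x y q. coeff (G x y q) b = u * x ^ n * y ^ m * q ^ c"
  then show ?thesis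
    using nz by (intro lowest_termI[where G = "\<lambda>x y q. smult (q * x) (G (\<beta> * x) (y / \<alpha>) q)"])
      (auto simp: app_qop power_mult_distrib power_divide)
qed

text \<open>The second summand of the action of \<open>X22\<close> carries a factor
  \<open>p\<close>, so only the diagonal part \<open>y\<close> reaches the constant term. The case
  \<open>b = 0\<close> suffices because \<open>X22\<close> stands last in a normal monomial and acts
  first.\<close>

lemma lowest_X22:
  assumes "lowest_term 0 n m c u v"
  shows "lowest_term 0 n (Suc m) c u (app (qop \<alpha> \<beta> X22) v)"
  using assms
proof (rule lowest_termE)
  fix G
  assume G: "\<And>x y p q. v (x, y, p, q) = poly (G x y q) p"
    "\<And>x y q j. j < 0 \<Longrightarrow> coeff (G x y q) j = 0"
    "\<And>x y q. coeff (G x y q) 0 = u * x ^ n * y ^ m * q ^ c"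
  then show ?thesis
    by (intro lowest_termI[where G = "\<lambda>x y q. smult y (G x y q)
          + pCons 0 (smult (q * x) (G (\<alpha> * \<beta> * x) (y / (\<alpha> * \<beta>)) q))"])
      (auto simp: app_qop)
qed

text \<open>The lowest term determines the exponents: \<open>b\<close> is the power of
  \<open>p\<close>, \<open>c\<close> that of \<open>q\<close>, \<open>d\<close> that of
  \<open>y\<close>, and then \<open>a\<close> follows from that of \<open>x\<close>. The scalar
  \<open>u\<close> collects the nonzero factors from the shifts.\<close>

lemma lowest_nmon:
  "\<exists>u. u \<noteq> 0 \<and> lowest_term b (a + b + c) d c u (app (rep (nmon (a, b, c, d))) (\<lambda>_. 1))"
proof -
  have "lowest_term 0 0 0 0 1 (\<lambda>_. 1 :: 'k)"
    by (rule lowest_termI[where G = "\<lambda>_ _ _. 1"]) simp_all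
  then have "lowest_term 0 0 d 0 1 (app (qop \<alpha> \<beta> X22 ^ d) (\<lambda>_. 1 :: 'k))"
    by (induction d) (simp_all add: app_simps lowest_X22)
  then have "\<exists>u. u \<noteq> 0 \<and> lowest_term 0 c d c u (app (qop \<alpha> \<beta> X21 ^ c * qop \<alpha> \<beta> X22 ^ d) (\<lambda>_. 1))"
  proof (induction c)
    case 0
    then show ?case by (intro exI[of _ 1]) simp
  next
    case (Suc c)
    then obtain u where u: "u \<noteq> 0" "lowest_term 0 c d c u (app (qop \<alpha> \<beta> X21 ^ c * qop \<alpha> \<beta> X22 ^ d) (\<lambda>_. 1))" by auto
    from lowest_X21[OF u(2)] u(1) nz show ?case
      by (intro exI[of _ "u * \<beta> ^ c / \<alpha> ^ d"]) (simp add: app_simps mult.assoc)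
  qed
  then have "\<exists>u. u \<noteq> 0 \<and> lowest_term b (b + c) d c u
      (app (qop \<alpha> \<beta> X12 ^ b * (qop \<alpha> \<beta> X21 ^ c * qop \<alpha> \<beta> X22 ^ d)) (\<lambda>_. 1))"
  proof (induction b)
    case (Suc b)
    then obtain u where u: "u \<noteq> 0" "lowest_term b (b + c) d c u
        (app (qop \<alpha> \<beta> X12 ^ b * (qop \<alpha> \<beta> X21 ^ c * qop \<alpha> \<beta> X22 ^ d)) (\<lambda>_. 1))" by auto
    from lowest_X12[OF u(2)] u(1) nz show ?case
      by (intro exI[of _ "u * \<alpha> ^ (b + c) / \<beta> ^ d"]) (simp add: app_simps mult.assoc)
  qed simp
  then obtain u where u: "u \<noteq> 0" "lowest_term b (b + c) d c u
      (app (qop \<alpha> \<beta> X12 ^ b * (qop \<alpha> \<beta> X21 ^ c * qop \<alpha> \<beta> X22 ^ d)) (\<lambda>_. 1))" by auto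
  from u(2) have "lowest_term b (a + (b + c)) d c u
      (app (qop \<alpha> \<beta> X11 ^ a * (qop \<alpha> \<beta> X12 ^ b * (qop \<alpha> \<beta> X21 ^ c * qop \<alpha> \<beta> X22 ^ d))) (\<lambda>_. 1))"
    by (induction a) (use lowest_X11 in \<open>simp_all add: app_simps mult.assoc\<close>)
  with u(1) show ?thesis by (auto simp: nmon_def rep_simps mult.assoc add.assoc)
qed

text \<open>Among the terms with nonzero coefficient, those with the least exponent
  \<open>b0\<close> of \<open>X12\<close> are the only ones that contribute to \<open>p^b0\<close>,
  and they do so by their lowest terms, which are told apart by their monomials in \<open>x\<close>,
  \<open>y\<close>, \<open>q\<close>.\<close>

lemma nmon_independent:
  assumes inf: "infinite (UNIV :: 'k set)" and E: "finite E"
    and eq: "rep (\<Sum>e\<in>E. free_const (k e) * nmon e) = 0" and e: "e \<in> E"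
  shows "k e = 0"
proof (rule ccontr)
  assume "k e \<noteq> 0"
  define E' where "E' = {e \<in> E. k e \<noteq> 0}"
  define B where "B e = fst (snd e)" for e :: "nat \<times> nat \<times> nat \<times> nat"
  have E': "finite E'" "e \<in> E'" using E e \<open>k e \<noteq> 0\<close> by (auto simp: E'_def)
  define e0 where "e0 = arg_min_on B E'"
  have e0: "e0 \<in> E'" and le: "B e0 \<le> B e" if "e \<in> E'" for e
    using E' that arg_min_if_finite[of E' B] by (auto simp: e0_def not_less[symmetric])
  obtain a0 b0 c0 d0 where e0_eq: "e0 = (a0, b0, c0, d0)" by (cases e0)
  have "\<forall>e. \<exists>u G. u \<noteq> 0 \<and> (\<forall>x y p q. app (rep (nmon e)) (\<lambda>_. 1) (x, y, p, q) = poly (G x y q) p)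
     \<and> (\<forall>x y q j. j < B e \<longrightarrow> coeff (G x y q) j = 0)
     \<and> (\<forall>x y q. coeff (G x y q) (B e) = u * x ^ (fst e + B e + fst (snd (snd e))) * y ^ snd (snd (snd e)) * q ^ fst (snd (snd e)))"
  proof
    fix e :: "nat \<times> nat \<times> nat \<times> nat"
    obtain a b c d where e: "e = (a, b, c, d)" by (cases e)
    from lowest_nmon[of b a c d] obtain u where u: "u \<noteq> 0"
      "lowest_term b (a + b + c) d c u (app (rep (nmon e)) (\<lambda>_. 1))" by (auto simp: e)
    from u(2) obtain G where "\<And>x y p q. app (rep (nmon e)) (\<lambda>_. 1) (x, y, p, q) = poly (G x y q) p"
      "\<And>x y q j. j < b \<Longrightarrow> coeff (G x y q) j = 0"
      "\<And>x y q. coeff (G x y q) b = u * x ^ (a + b + c) * y ^ d * q ^ c"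
      by (rule lowest_termE) blast
    with u(1) show "\<exists>u G. u \<noteq> 0 \<and> (\<forall>x y p q. app (rep (nmon e)) (\<lambda>_. 1) (x, y, p, q) = poly (G x y q) p)
     \<and> (\<forall>x y q j. j < B e \<longrightarrow> coeff (G x y q) j = 0)
     \<and> (\<forall>x y q. coeff (G x y q) (B e) = u * x ^ (fst e + B e + fst (snd (snd e))) * y ^ snd (snd (snd e)) * q ^ fst (snd (snd e)))"
      by (intro exI[of _ u] exI[of _ G]) (simp add: e B_def)
  qed
  then obtain u G where u: "\<And>e. u e \<noteq> 0"
    and G: "\<And>e x y p q. app (rep (nmon e)) (\<lambda>_. 1) (x, y, p, q) = poly (G e x y q) p"
    and G_lt: "\<And>e x y q j. j < B e \<Longrightarrow> coeff (G e x y q) j = 0"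
    and G_eq: "\<And>e x y q. coeff (G e x y q) (B e)
      = u e * x ^ (fst e + B e + fst (snd (snd e))) * y ^ snd (snd (snd e)) * q ^ fst (snd (snd e))"
    by metis
  define A where "A = {e \<in> E'. B e = b0}"
  have "(\<Sum>e\<in>A. k e * u e * x ^ (fst e + B e + fst (snd (snd e))) * y ^ snd (snd (snd e)) * q ^ fst (snd (snd e))) = 0"
    for x y q
  proof -
    define P where "P = (\<Sum>e\<in>E'. smult (k e) (G e x y q))"
    have "poly P p = 0" for p
    proof -
      have "poly P p = (\<Sum>e\<in>E. k e * poly (G e x y q) p)"
        unfolding P_def poly_sum poly_smult E'_def using E by (intro sum.mono_neutral_left) auto
      also have "\<dots> = app (rep (\<Sum>e\<in>E. free_const (k e) * nmon e)) (\<lambda>_. 1) (x, y, p, q)"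
        by (simp add: rep_simps app_sum app_simps scal.rep_eq G)
      finally show ?thesis by (simp add: eq app_simps)
    qed
    then have "P = 0" using inf poly_roots_finite[of P] by auto
    then have "0 = coeff P b0" by simp
    also have "\<dots> = (\<Sum>e\<in>E'. k e * coeff (G e x y q) b0)" by (simp add: P_def coeff_sum)
    also have "\<dots> = (\<Sum>e\<in>A. k e * coeff (G e x y q) b0)"
    proof (rule sum.mono_neutral_right)
      show "\<forall>e\<in>E' - A. k e * coeff (G e x y q) b0 = 0"
      proof
        fix e assume "e \<in> E' - A"
        with le[of e] have "b0 < B e" by (auto simp: A_def e0_eq B_def)
        then show "k e * coeff (G e x y q) b0 = 0" by (simp add: G_lt)
      qed
    qed (auto simp: A_def E')
    also have "\<dots> = (\<Sum>e\<in>A. k e * u e * x ^ (fst e + B e + fst (snd (snd e))) * y ^ snd (snd (snd e)) * q ^ fst (snd (snd e)))"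
    proof (intro sum.cong refl)
      fix e assume "e \<in> A"
      then have "b0 = B e" by (simp add: A_def)
      then show "k e * coeff (G e x y q) b0
          = k e * u e * x ^ (fst e + B e + fst (snd (snd e))) * y ^ snd (snd (snd e)) * q ^ fst (snd (snd e))"
        by (simp only: G_eq mult.assoc)
    qed
    finally show ?thesis by simp
  qed
  moreover have A: "finite A" using E' by (simp add: A_def)
  \<comment> \<open>Coefficients in \<open>q\<close>, then \<open>y\<close>, then \<open>x\<close>
    are compared; with \<open>b0\<close> fixed, the three exponents leave only
    \<open>e0\<close>.\<close>
  ultimately have "(\<Sum>e | e \<in> A \<and> fst (snd (snd e)) = c0.
      k e * u e * x ^ (fst e + B e + fst (snd (snd e))) * y ^ snd (snd (snd e))) = 0" for x y
    by (intro sum_power_eq_0[OF inf, where f = "\<lambda>e. fst (snd (snd e))"]) auto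
  then have "(\<Sum>e | e \<in> {e. e \<in> A \<and> fst (snd (snd e)) = c0} \<and> snd (snd (snd e)) = d0.
      k e * u e * x ^ (fst e + B e + fst (snd (snd e)))) = 0" for x
    using A by (intro sum_power_eq_0[OF inf, where f = "\<lambda>e. snd (snd (snd e))"]) auto
  then have "(\<Sum>e | e \<in> {e. e \<in> {e. e \<in> A \<and> fst (snd (snd e)) = c0} \<and> snd (snd (snd e)) = d0}
      \<and> fst e + B e + fst (snd (snd e)) = a0 + b0 + c0. k e * u e) = 0"
    using A by (intro sum_power_eq_0[OF inf, where f = "\<lambda>e. fst e + B e + fst (snd (snd e))"]) auto
  also have "{e. e \<in> {e. e \<in> {e. e \<in> A \<and> fst (snd (snd e)) = c0} \<and> snd (snd (snd e)) = d0}
      \<and> fst e + B e + fst (snd (snd e)) = a0 + b0 + c0} = {e0}"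
    using e0[OF E'(2)] by (auto simp: A_def B_def e0_eq)
  finally show False using u e0[OF E'(2)] by (simp add: E'_def)
qed

theorem rep_faithful:
  assumes inf: "infinite (UNIV :: 'k set)" and "rep f = 0"
  shows "f \<in> I"
proof -
  obtain E k where E: "finite E" "f \<approx> (\<Sum>e\<in>E. free_const (k e) * nmon e)"
    using nspan_expand[OF nspan_UNIV] by blast
  then have "rep (\<Sum>e\<in>E. free_const (k e) * nmon e) = 0"
    using rep_ideal[of "f - (\<Sum>e\<in>E. free_const (k e) * nmon e)"] assms(2) by (simp add: cong_def rep_simps(3))
  then have "k e = 0" if "e \<in> E" for e
    using nmon_independent[OF inf E(1) _ that] by blast
  with E(2) show ?thesis by (simp add: cong_def free_const_simps)
qed

end

section \<open>Roots of unity\<close>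

lemma power_eq_1_iff_unit_ord:
  fixes \<xi> :: "'k::field"
  assumes "\<xi> \<noteq> 0"
  shows "\<xi> ^ n = 1 \<longleftrightarrow> unit_ord \<xi> dvd n"
proof -
  let ?R = "ring_of_type_algebra :: 'k ring"
  interpret R: Ring.field ?R by (rule field_from_type_algebra)
  \<comment> \<open>The unit group occurs under two equal definitions; the one behind
    \<open>unit_ord\<close> inherits the group property from the other.\<close>
  have grp: "group (Ring_Divisibility.mult_of ?R)"
    using R.field_mult_group by (simp add: Ring_Divisibility.mult_of_def Multiplicative_Group.mult_of_def)
  have car: "\<xi> \<in> carrier (Ring_Divisibility.mult_of ?R)"
    using assms by (simp add: ring_of_type_algebra_def)
  have pow: "\<xi> [^]\<^bsub>Ring_Divisibility.mult_of ?R\<^esub> n = \<xi> ^ n"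
    by (induction n) (simp_all add: ring_of_type_algebra_def mult.commute)
  have one: "\<one>\<^bsub>Ring_Divisibility.mult_of ?R\<^esub> = 1" by (simp add: ring_of_type_algebra_def)
  from group.pow_eq_id[OF grp car, of n] show ?thesis
    unfolding pow one unit_ord_def .
qed

lemma unit_ord_pos:
  fixes \<xi> :: "'k::field"
  assumes "\<xi> \<noteq> 0" "root_of_unity \<xi>"
  shows "unit_ord \<xi> > 0"
proof -
  obtain n where "n > 0" "\<xi> ^ n = 1" using assms(2) by (auto simp: root_of_unity_def)
  then have "unit_ord \<xi> dvd n" by (simp add: power_eq_1_iff_unit_ord[OF assms(1)])
  with \<open>n > 0\<close> show ?thesis by (auto intro: dvd_pos_nat)
qed

lemma root_of_unity_mult:
  assumes "root_of_unity \<xi>" "root_of_unity \<eta>"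
  shows "root_of_unity (\<xi> * \<eta>)"
proof -
  obtain m n where mn: "m > 0" "n > 0" "\<xi> ^ m = 1" "\<eta> ^ n = 1"
    using assms by (auto simp: root_of_unity_def)
  then have "\<xi> ^ (m * n) = 1" "\<eta> ^ (n * m) = 1" by (simp_all add: power_mult)
  then have "(\<xi> * \<eta>) ^ (m * n) = 1" by (simp add: power_mult_distrib mult.commute[of m n])
  with mn show ?thesis by (auto simp: root_of_unity_def intro!: exI[of _ "m * n"])
qed

lemma root_of_unity_inverse: "root_of_unity \<xi> \<Longrightarrow> root_of_unity (inverse \<xi>)"
  by (auto simp: root_of_unity_def power_inverse)

lemma power_unit_ord_eq_iff:
  fixes \<xi> :: "'k::field"
  assumes "\<xi> \<noteq> 0" "i < unit_ord \<xi>" "j < unit_ord \<xi>"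
  shows "\<xi> ^ i = \<xi> ^ j \<longleftrightarrow> i = j"
proof -
  have "i = j" if "\<xi> ^ i = \<xi> ^ j" "i \<le> j" "j < unit_ord \<xi>" for i j
  proof -
    have "\<xi> ^ j = \<xi> ^ i * \<xi> ^ (j - i)" using that(2) by (simp flip: power_add)
    with that(1) assms(1) have "\<xi> ^ (j - i) = 1" by simp
    then have "unit_ord \<xi> dvd j - i" by (simp add: power_eq_1_iff_unit_ord[OF assms(1)])
    with that nat_dvd_not_less[of "j - i" "unit_ord \<xi>"] show ?thesis
      by (cases "i < j") (auto simp: less_imp_diff_less)
  qed
  with assms show ?thesis by (metis nat_le_linear)
qed

text \<open>The distinct powers of \<open>\<xi>\<close> already exhaust the at most \<open>r\<close>
  roots of \<open>t^r - 1\<close>. Membership in the cyclic group thereby becomes a single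
  equation.\<close>

lemma roots_of_unity_powers:
  fixes \<xi> :: "'k::field"
  assumes nz: "\<xi> \<noteq> 0" and pos: "unit_ord \<xi> > 0"
  shows "range (\<lambda>c::nat. \<xi> ^ c) = {t. t ^ unit_ord \<xi> = 1}"
    and "card (range (\<lambda>c::nat. \<xi> ^ c)) = unit_ord \<xi>"
proof -
  let ?r = "unit_ord \<xi>"
  define P where "P = monom (1::'k) ?r + [:- 1:]"
  have "degree P = ?r"
    unfolding P_def using pos by (subst degree_add_eq_left) (simp_all add: degree_monom_eq)
  moreover have P0: "P \<noteq> 0" using calculation pos by auto
  moreover have roots: "{t. poly P t = 0} = {t :: 'k. t ^ ?r = 1}" by (auto simp: P_def poly_monom)
  ultimately have le: "card {t :: 'k. t ^ ?r = 1} \<le> ?r"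
    using card_poly_roots_bound[of P] by simp
  have fin: "finite {t :: 'k. t ^ ?r = 1}" using poly_roots_finite[OF P0] by (simp add: roots)
  have sub: "range (\<lambda>c::nat. \<xi> ^ c) \<subseteq> {t :: 'k. t ^ ?r = 1}"
    using power_eq_1_iff_unit_ord[OF nz, of ?r] by (auto simp: power_mult[symmetric] mult.commute[of _ ?r]) (simp add: power_mult)
  have "card ((\<lambda>c::nat. \<xi> ^ c) ` {..<?r}) = ?r"
    by (subst card_image) (auto simp: inj_on_def power_unit_ord_eq_iff[OF nz])
  moreover have "(\<lambda>c::nat. \<xi> ^ c) ` {..<?r} \<subseteq> range (\<lambda>c::nat. \<xi> ^ c)" by auto
  ultimately have "?r \<le> card (range (\<lambda>c::nat. \<xi> ^ c))"
    using card_mono finite_subset[OF sub fin] by metis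
  with le card_mono[OF fin sub] show "card (range (\<lambda>c::nat. \<xi> ^ c)) = ?r" by simp
  with le card_mono[OF fin sub] show "range (\<lambda>c::nat. \<xi> ^ c) = {t :: 'k. t ^ ?r = 1}"
    using card_subset_eq[OF fin sub] by simp
qed

section \<open>The order of the group of eigenvalue shifts\<close>

text \<open>For roots of unity, the group generated by \<open>(\<alpha>, \<beta>)\<close> and
  \<open>(\<beta>, \<alpha>)\<close>: natural exponents also reach the inverses. The second
  coordinate is inverted relative to the action, which divides \<open>y\<close> by it.\<close>

definition twist_group :: "'k::field \<Rightarrow> 'k \<Rightarrow> ('k \<times> 'k) set" where
  "twist_group \<alpha> \<beta> = {(\<alpha> ^ i * \<beta> ^ j, \<alpha> ^ j * \<beta> ^ i) | i j. True}"

text \<open>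
  The quotient of the two coordinates maps the group onto the powers of \<open>\<alpha> / \<beta>\<close>, of order \<open>s\<close>.
  The kernel is generated by \<open>\<alpha> \<beta>\<close> and \<open>\<beta>\<^sup>s = \<alpha>\<^sup>s\<close>, whose square is a power of \<open>\<alpha> \<beta>\<close>.
\<close>

lemma card_twist_group:
  fixes \<alpha> \<beta> :: "'k::field"
  assumes nz: "\<alpha> \<noteq> 0" "\<beta> \<noteq> 0" and ru: "root_of_unity \<alpha>" "root_of_unity \<beta>"
  defines "r \<equiv> unit_ord (\<alpha> * \<beta>)" and "s \<equiv> unit_ord (\<alpha> * inverse \<beta>)"
  shows "finite (twist_group \<alpha> \<beta>)"
    and "card (twist_group \<alpha> \<beta>) = (if unit_ord \<beta> dvd r * s then r * s else 2 * r * s)"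
proof -
  have r: "r > 0" unfolding r_def using nz ru by (intro unit_ord_pos root_of_unity_mult) auto
  have s: "s > 0" unfolding s_def using nz ru by (intro unit_ord_pos root_of_unity_mult root_of_unity_inverse) auto
  have "(\<alpha> * inverse \<beta>) ^ s = 1"
    using power_eq_1_iff_unit_ord[of "\<alpha> * inverse \<beta>" s] nz by (simp add: s_def)
  then have as: "\<alpha> ^ s = \<beta> ^ s"
    using nz by (simp add: power_mult_distrib power_inverse field_simps)
  have b2s: "\<beta> ^ s * \<beta> ^ s = (\<alpha> * \<beta>) ^ s"
    by (simp add: power_mult_distrib as)
  define R where "R = range (\<lambda>c::nat. (\<alpha> * \<beta>) ^ c)"
  have R_eq: "R = {t. t ^ r = 1}" and card_R: "card R = r"
    unfolding R_def r_def using nz r roots_of_unity_powers[of "\<alpha> * \<beta>"] by (auto simp: r_def)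
  have fin_R: "finite R" using card_R r by (simp add: card_ge_0_finite)
  define P where "P = R \<union> (\<lambda>t. \<beta> ^ s * t) ` R"
  have fin_P: "finite P" using fin_R by (simp add: P_def)
  have card_P: "card P = (if unit_ord \<beta> dvd r * s then r else 2 * r)"
  proof -
    \<comment> \<open>The source of the divisibility condition: \<open>R\<close> consists of all
      \<open>r\<close>-th roots of unity, so \<open>\<beta> ^ s \<in> R\<close> means
      \<open>\<beta> ^ (r * s) = 1\<close>.\<close>
    have iff: "\<beta> ^ s \<in> R \<longleftrightarrow> unit_ord \<beta> dvd r * s"
      using power_eq_1_iff_unit_ord[OF nz(2), of "r * s"] by (simp add: R_eq power_mult[symmetric] mult.commute)
    show ?thesis
    proof (cases "\<beta> ^ s \<in> R")
      case True
      then have "(\<lambda>t. \<beta> ^ s * t) ` R \<subseteq> R" by (auto simp: R_eq power_mult_distrib)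
      then have "P = R" by (auto simp: P_def)
      with True iff card_R show ?thesis by simp
    next
      case False
      have "R \<inter> (\<lambda>t. \<beta> ^ s * t) ` R = {}"
      proof (rule ccontr)
        assume "R \<inter> (\<lambda>t. \<beta> ^ s * t) ` R \<noteq> {}"
        then obtain t where "t ^ r = 1" "(\<beta> ^ s * t) ^ r = 1" by (auto simp: R_eq)
        then have "\<beta> ^ s \<in> R" by (simp add: R_eq power_mult_distrib)
        with False show False by simp
      qed
      moreover have "card ((\<lambda>t. \<beta> ^ s * t) ` R) = r"
        using nz card_R by (subst card_image) (auto simp: inj_on_def)
      ultimately have "card P = 2 * r"
        using fin_R card_R by (simp add: P_def card_Un_disjoint)
      with False iff show ?thesis by simp
    qed
  qed
  have P_pow: "(\<alpha> * \<beta>) ^ c * \<beta> ^ (s * m) \<in> P" for c m :: nat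
  proof -
    have even: "\<beta> ^ (s * (2 * l)) = (\<alpha> * \<beta>) ^ (s * l)" for l :: nat
    proof -
      have "\<beta> ^ (s * (2 * l)) = (\<beta> ^ s * \<beta> ^ s) ^ l" by (simp add: power_mult power2_eq_square)
      then show ?thesis by (simp add: b2s power_mult)
    qed
    show ?thesis
    proof (cases "even m")
      case True
      then obtain l where "m = 2 * l" by blast
      then have "(\<alpha> * \<beta>) ^ c * \<beta> ^ (s * m) = (\<alpha> * \<beta>) ^ (c + s * l)" by (simp add: even power_add)
      then show ?thesis by (auto simp: P_def R_def)
    next
      case False
      then obtain l where "m = 2 * l + 1" by (blast elim: oddE)
      then have "\<beta> ^ (s * m) = \<beta> ^ s * \<beta> ^ (s * (2 * l))" by (simp add: algebra_simps power_add)
      then have "(\<alpha> * \<beta>) ^ c * \<beta> ^ (s * m) = \<beta> ^ s * (\<alpha> * \<beta>) ^ (c + s * l)"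
        by (simp add: even power_add)
      then show ?thesis unfolding P_def R_def by blast
    qed
  qed
  \<comment> \<open>The pairs \<open>(\<alpha> ^ k, \<beta> ^ k)\<close> with \<open>k < s\<close>
    represent the cosets of the diagonal pairs \<open>(t, t)\<close>,
    \<open>t \<in> P\<close>.\<close>
  define f where "f = (\<lambda>(k::nat, t). (\<alpha> ^ k * t, \<beta> ^ k * t))"
  have inj: "inj_on f ({..<s} \<times> P)"
  proof (rule inj_onI, clarify)
    fix k l t u assume kl: "k < s" "l < s" and tu: "t \<in> P" "u \<in> P" and "f (k, t) = f (l, u)"
    then have eq: "\<alpha> ^ k * t = \<alpha> ^ l * u" "\<beta> ^ k * t = \<beta> ^ l * u" by (auto simp: f_def)
    have "t \<noteq> 0" using tu(1) nz by (auto simp: P_def R_def)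
    then have "u \<noteq> 0" using eq nz by auto
    have "(\<alpha> ^ k * \<beta> ^ l) * (t * u) = (\<alpha> ^ k * t) * (\<beta> ^ l * u)" by simp
    also have "\<dots> = (\<alpha> ^ l * \<beta> ^ k) * (t * u)" by (simp add: eq(1)) (simp add: eq(2)[symmetric])
    finally have "\<alpha> ^ k * \<beta> ^ l = \<alpha> ^ l * \<beta> ^ k" using \<open>t \<noteq> 0\<close> \<open>u \<noteq> 0\<close> by simp
    then have "(\<alpha> * inverse \<beta>) ^ k = (\<alpha> * inverse \<beta>) ^ l"
      using nz by (simp add: power_mult_distrib power_inverse field_simps)
    then have "k = l" using power_unit_ord_eq_iff[of "\<alpha> * inverse \<beta>" k l] nz kl by (simp add: s_def)
    with eq(1) nz show "k = l \<and> t = u" by simp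
  qed
  have "twist_group \<alpha> \<beta> = f ` ({..<s} \<times> P)"
  proof (intro equalityI subsetI)
    fix w assume "w \<in> twist_group \<alpha> \<beta>"
    then obtain i j where w: "w = (\<alpha> ^ i * \<beta> ^ j, \<alpha> ^ j * \<beta> ^ i)" by (auto simp: twist_group_def)
    obtain n where n: "n > 0" "\<alpha> ^ n = 1" "\<beta> ^ n = 1"
    proof -
      obtain a b where ab: "a > 0" "b > 0" "\<alpha> ^ a = 1" "\<beta> ^ b = 1" using ru by (auto simp: root_of_unity_def)
      then have "\<alpha> ^ (a * b) = 1" "\<beta> ^ (b * a) = 1" by (simp_all add: power_mult)
      with ab show thesis by (intro that[of "a * b"]) (simp_all add: mult.commute[of a b])
    qed
    \<comment> \<open>As \<open>n\<close> is a common period, adding \<open>n * j\<close> changes no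
      power but ensures \<open>j \<le> i'\<close>. Then \<open>(\<alpha> * \<beta>) ^ j\<close>
      splits off from both coordinates and leaves the exponent \<open>d\<close>.\<close>
    define i' where "i' = i + n * j"
    have "j \<le> i'" using n(1) by (cases n) (simp_all add: i'_def)
    then obtain d where d: "i' = j + d" using le_Suc_ex by blast
    define k m where "k = d mod s" and "m = d div s"
    have dkm: "d = k + s * m" by (simp add: k_def m_def)
    have "w = (\<alpha> ^ i' * \<beta> ^ j, \<alpha> ^ j * \<beta> ^ i')"
      by (simp add: w i'_def power_add power_mult n)
    also have "\<dots> = f (k, (\<alpha> * \<beta>) ^ j * \<beta> ^ (s * m))"
      by (simp add: f_def d dkm power_add power_mult power_mult_distrib as)
    finally show "w \<in> f ` ({..<s} \<times> P)"
      using P_pow[of j m] s by (auto simp: k_def)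
  next
    fix w assume "w \<in> f ` ({..<s} \<times> P)"
    then obtain k t where w: "w = (\<alpha> ^ k * t, \<beta> ^ k * t)" and "t \<in> P" by (auto simp: f_def)
    then consider c where "t = (\<alpha> * \<beta>) ^ c" | c where "t = \<beta> ^ s * (\<alpha> * \<beta>) ^ c"
      by (auto simp: P_def R_def)
    then show "w \<in> twist_group \<alpha> \<beta>"
    proof cases
      case 1
      then show ?thesis unfolding twist_group_def w
        by (intro CollectI exI[of _ "k + c"] exI[of _ c]) (simp add: power_add power_mult_distrib)
    next
      case 2
      then show ?thesis unfolding twist_group_def w
        by (intro CollectI exI[of _ "k + c"] exI[of _ "s + c"]) (simp add: power_add power_mult_distrib as)
    qed
  qed
  with inj fin_P card_P show "finite (twist_group \<alpha> \<beta>)"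
    "card (twist_group \<alpha> \<beta>) = (if unit_ord \<beta> dvd r * s then r * s else 2 * r * s)"
    by (simp_all add: card_image card_cartesian_product)
qed

text \<open>Over a finite field, 1 plus the product of all \<open>t - a\<close> is a nonconstant
  polynomial without roots.\<close>

lemma infinite_alg_closed: "infinite (UNIV :: 'k::alg_closed_field set)"
proof
  assume fin: "finite (UNIV :: 'k set)"
  define P where "P = (\<Prod>a\<in>UNIV. [:- a, 1:]) + (1 :: 'k poly)"
  have deg: "degree (\<Prod>a\<in>(UNIV::'k set). [:- a, 1:]) = card (UNIV :: 'k set)"
    by (subst degree_prod_eq_sum_degree) auto
  have "card (UNIV :: 'k set) > 0" using fin by (simp add: finite_UNIV_card_ge_0)
  then have "degree P > 0" unfolding P_def by (subst degree_add_eq_left) (simp_all add: deg)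
  then obtain x where "poly P x = 0" using alg_closed_imp_poly_has_root by blast
  moreover have "poly P x = 1" using fin by (simp add: P_def poly_prod prod_zero_iff)
  ultimately show False by simp
qed

section \<open>The standard identity\<close>

lemma lookup_free_var_times:
  fixes f :: "('x, 'k::field) free_alg"
  shows "Poly_Mapping.lookup (free_var x * f) (Word ws)
    = (case ws of [] \<Rightarrow> 0 | y # ys \<Rightarrow> if y = x then Poly_Mapping.lookup f (Word ys) else 0)"
proof -
  have single: "free_var x * Poly_Mapping.single w c = Poly_Mapping.single (Word (x # letters w)) c" for w and c :: 'k
    by (simp add: free_var_def mult_single plus_word_def)
  have "Poly_Mapping.lookup (free_var x * f) (Word ws)
      = (\<Sum>w\<in>Poly_Mapping.keys f. Poly_Mapping.lookup f w when Word (x # letters w) = Word ws)"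
    by (subst poly_mapping_single_sum[of f]) (simp add: sum_distrib_left lookup_sum single lookup_single)
  also have "\<dots> = (case ws of [] \<Rightarrow> 0 | y # ys \<Rightarrow> if y = x then Poly_Mapping.lookup f (Word ys) else 0)"
  proof (cases ws)
    case (Cons y ys)
    have "(Poly_Mapping.lookup f w when Word (x # letters w) = Word ws)
        = (if w = Word ys then if y = x then Poly_Mapping.lookup f (Word ys) else 0 else 0)" for w
      by (cases w) (auto simp: Cons when_def)
    then show ?thesis by (simp add: Cons in_keys_iff)
  qed simp
  finally show ?thesis .
qed

lemma lookup_of_int_times:
  fixes f :: "('x, 'k::field) free_alg"
  shows "Poly_Mapping.lookup (of_int k * f) w = of_int k * Poly_Mapping.lookup f w"
proof -
  have nat: "Poly_Mapping.lookup (of_nat n * f) w = of_nat n * Poly_Mapping.lookup f w" for n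
    by (induction n) (simp_all add: distrib_right lookup_add)
  show ?thesis by (cases k rule: int_cases2) (simp_all add: nat)
qed

lemma keys_stdp:
  assumes "finite S" "w \<in> Poly_Mapping.keys (stdp free_var S :: 'k::field nc_poly)"
  shows "distinct (letters w) \<and> set (letters w) = S"
  using assms
proof (induction S arbitrary: w rule: finite_remove_induct')
  case empty
  then have "w \<in> Poly_Mapping.keys (Poly_Mapping.single 0 1 :: 'k nc_poly)" by (simp only: stdp_empty single_one)
  then show ?case by (simp add: zero_word_def)
next
  case (remove S)
  have "Poly_Mapping.lookup (stdp free_var S :: 'k nc_poly) w \<noteq> 0" using remove.prems by (simp add: in_keys_iff)
  then have "(\<Sum>x\<in>S. of_int (shuffle_sign {x} (S - {x}))
      * Poly_Mapping.lookup (free_var x * (stdp free_var (S - {x}) :: 'k nc_poly)) w) \<noteq> 0"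
    unfolding stdp_rec[OF remove.hyps] lookup_sum mult.assoc lookup_of_int_times .
  then obtain x where x: "x \<in> S" "Poly_Mapping.lookup (free_var x * (stdp free_var (S - {x}) :: 'k nc_poly)) w \<noteq> 0"
    by (metis (no_types, lifting) mult_zero_right sum.neutral)
  obtain ws where w: "w = Word ws" by (cases w)
  from x(2) obtain ys where ys: "ws = x # ys" "Poly_Mapping.lookup (stdp free_var (S - {x}) :: 'k nc_poly) (Word ys) \<noteq> 0"
    by (auto simp: w lookup_free_var_times split: list.splits if_splits)
  from remove.IH[OF x(1), of "Word ys"] ys(2) show ?case
    using x(1) by (auto simp: w ys(1) in_keys_iff)
qed

text \<open>The increasing word has no inversions, so its coefficient is \<open>1\<close> rather
  than \<open>-1\<close>; it is the witness for \<open>nc_monic\<close>.\<close>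

lemma lookup_stdp_sorted:
  "finite S \<Longrightarrow> Poly_Mapping.lookup (stdp free_var S :: 'k::field nc_poly) (Word (sorted_list_of_set S)) = 1"
proof (induction S rule: finite_remove_induct')
  case empty
  show ?case by (simp add: lookup_one zero_word_def)
next
  case (remove S)
  define m where "m = Min S"
  have m: "m \<in> S" and sorted: "sorted_list_of_set S = m # sorted_list_of_set (S - {m})"
    using remove.hyps by (simp_all add: m_def sorted_list_of_set_nonempty)
  have "{(s, t). s \<in> {m} \<and> t \<in> S - {m} \<and> t < s} = {}"
    using remove.hyps Min_le[of S] by (auto simp: m_def not_less[symmetric])
  then have sgn: "shuffle_sign {m} (S - {m}) = 1" by (simp only: shuffle_sign_def card.empty power_0)
  have "Poly_Mapping.lookup (stdp free_var S :: 'k nc_poly) (Word (sorted_list_of_set S))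
    = (\<Sum>x\<in>S. of_int (shuffle_sign {x} (S - {x})) * (if m = x
         then Poly_Mapping.lookup (stdp free_var (S - {x}) :: 'k nc_poly) (Word (sorted_list_of_set (S - {m}))) else 0))"
    unfolding stdp_rec[OF remove.hyps] lookup_sum mult.assoc lookup_of_int_times lookup_free_var_times sorted by simp
  also have "\<dots> = (\<Sum>x\<in>S. if x = m then of_int (shuffle_sign {m} (S - {m}))
      * Poly_Mapping.lookup (stdp free_var (S - {m}) :: 'k nc_poly) (Word (sorted_list_of_set (S - {m}))) else 0)"
    by (intro sum.cong refl) auto
  also have "\<dots> = 1" using m remove by (simp add: sgn)
  finally show ?case .
qed

lemma stdp_nc_poly:
  assumes "finite S"
  shows "nc_degree (stdp free_var S :: 'k::field nc_poly) = card S"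
    and "nc_monic (stdp free_var S :: 'k nc_poly)" and "nc_multilinear (stdp free_var S :: 'k nc_poly)"
proof -
  let ?F = "stdp free_var S :: 'k nc_poly"
  let ?w = "Word (sorted_list_of_set S)"
  have w: "?w \<in> Poly_Mapping.keys ?F" using lookup_stdp_sorted[OF assms, where 'k = 'k] by (simp add: in_keys_iff)
  have "length (letters w) = card S" if "w \<in> Poly_Mapping.keys ?F" for w
    using keys_stdp[OF assms that] distinct_card by metis
  then have "(\<lambda>w. length (letters w)) ` Poly_Mapping.keys ?F = {card S}"
    using w by (auto simp: image_iff)
  then show deg: "nc_degree ?F = card S" by (simp add: nc_degree_def)
  show "nc_monic ?F"
    unfolding nc_monic_def deg using w lookup_stdp_sorted[OF assms, where 'k = 'k] assms by (intro bexI[of _ ?w]) simp_all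
  show "nc_multilinear ?F"
    unfolding nc_multilinear_def using keys_stdp[OF assms, where 'k = 'k] by blast
qed

context qmat
begin

definition orbit :: "'k \<times> 'k \<times> 'k \<times> 'k \<Rightarrow> ('k \<times> 'k \<times> 'k \<times> 'k) set" where
  "orbit = (\<lambda>(x, y, p, q). (\<lambda>(s, t). (s * x, y / t, p, q)) ` twist_group \<alpha> \<beta>)"

lemma orbit_self: "z \<in> orbit z"
proof (cases z)
  case (fields x y p q)
  have "(1, 1) \<in> twist_group \<alpha> \<beta>"
    unfolding twist_group_def by (intro CollectI exI[of _ 0]) simp
  then show ?thesis by (force simp: fields orbit_def)
qed

lemma orbit_step:
  assumes "(x, y, p, q) \<in> orbit z"
  shows "(\<alpha> * x, y / \<beta>, p, q) \<in> orbit z" "(\<beta> * x, y / \<alpha>, p, q) \<in> orbit z"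
    "(\<alpha> * \<beta> * x, y / (\<alpha> * \<beta>), p, q) \<in> orbit z"
proof -
  obtain x0 y0 where z: "z = (x0, y0, p, q)" using assms by (cases z) (auto simp: orbit_def)
  obtain i j where ij: "x = \<alpha> ^ i * \<beta> ^ j * x0" "y = y0 / (\<alpha> ^ j * \<beta> ^ i)"
    using assms by (auto simp: z orbit_def twist_group_def)
  have mem: "(\<alpha> ^ k * \<beta> ^ l * x0, y0 / (\<alpha> ^ l * \<beta> ^ k), p, q) \<in> orbit z" for k l
    unfolding z orbit_def twist_group_def by (auto intro!: image_eqI[where x = "(\<alpha> ^ k * \<beta> ^ l, \<alpha> ^ l * \<beta> ^ k)"])
  from mem[of "Suc i" j] mem[of i "Suc j"] mem[of "Suc i" "Suc j"]
  show "(\<alpha> * x, y / \<beta>, p, q) \<in> orbit z" "(\<beta> * x, y / \<alpha>, p, q) \<in> orbit z"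
    "(\<alpha> * \<beta> * x, y / (\<alpha> * \<beta>), p, q) \<in> orbit z"
    by (simp_all add: ij mult_ac)
qed

text \<open>To compute a value at a point, each generator reads values only at points of the same
  orbit; this passes to sums and products.\<close>

lemma local_on_rep:
  assumes fin: "finite (orbit z)"
  shows "local_on (orbit z) (rep f)"
proof -
  have gen: "local_on (orbit z) (qop \<alpha> \<beta> g)" for g
  proof (rule local_onI[OF fin, where t = "\<lambda>(x, y, p, q) w. case g of
       X11 \<Rightarrow> if w = (x, y, p, q) then x else 0
     | X12 \<Rightarrow> if w = (\<alpha> * x, y / \<beta>, p, q) then p * x else 0
     | X21 \<Rightarrow> if w = (\<beta> * x, y / \<alpha>, p, q) then q * x else 0
     | X22 \<Rightarrow> (if w = (x, y, p, q) then y else 0) + (if w = (\<alpha> * \<beta> * x, y / (\<alpha> * \<beta>), p, q) then p * q * x else 0)"])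
    fix v :: "'k \<times> 'k \<times> 'k \<times> 'k \<Rightarrow> 'k" and w assume w: "w \<in> orbit z"
    obtain x y p q where w_eq: "w = (x, y, p, q)" by (cases w)
    have delta: "(\<Sum>u\<in>orbit z. (if u = u0 then c else 0) * v u) = c * v u0" if "u0 \<in> orbit z" for u0 c
    proof -
      have "(if u = u0 then c else 0) * v u = (if u = u0 then c * v u0 else 0)" for u by simp
      then show ?thesis using fin that by simp
    qed
    show "app (qop \<alpha> \<beta> g) v w = (\<Sum>u\<in>orbit z. (case w of (x, y, p, q) \<Rightarrow> \<lambda>w. case g of
       X11 \<Rightarrow> if w = (x, y, p, q) then x else 0
     | X12 \<Rightarrow> if w = (\<alpha> * x, y / \<beta>, p, q) then p * x else 0
     | X21 \<Rightarrow> if w = (\<beta> * x, y / \<alpha>, p, q) then q * x else 0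
     | X22 \<Rightarrow> (if w = (x, y, p, q) then y else 0) + (if w = (\<alpha> * \<beta> * x, y / (\<alpha> * \<beta>), p, q) then p * q * x else 0)) u * v u)"
      using w orbit_step[of x y p q z]
      by (cases g) (simp_all add: w_eq app_qop delta distrib_right sum.distrib del: prod.inject)
  qed
  have "local_on (orbit z) (prod_list (map (qop \<alpha> \<beta>) xs))" for xs
    by (induction xs) (simp_all add: fin gen local_on_mult)
  then show ?thesis
    unfolding rep_def ls.free_eval_def by (intro local_on_sum local_on_scal)
qed

text \<open>By faithfulness it suffices to compare values at each point \<open>z\<close>. These
  depend only on the block of the orbit of \<open>z\<close>, whose size is at most that of the
  group.\<close>

lemma stdp_in_ideal:
  assumes inf: "infinite (UNIV :: 'k set)" and fin: "finite (twist_group \<alpha> \<beta>)"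
    and S: "finite S" "card S \<ge> 2 * card (twist_group \<alpha> \<beta>)"
  shows "stdp g S \<in> I"
proof (rule rep_faithful[OF inf], rule lop_eqI)
  fix v z
  have fin': "finite (orbit z)" and card: "card (orbit z) \<le> card (twist_group \<alpha> \<beta>)"
    using fin by (auto simp: orbit_def card_image_le split: prod.split)
  have eq: "rep (stdp g S) = stdp (\<lambda>x. rep (g x)) S"
    by (simp add: rep_def ls.free_eval_stdp)
  have "entry (stdp (\<lambda>x. rep (g x)) S) z w = 0" if "w \<in> orbit z" for w
    using S card that by (intro amitsur_levitzki_le[OF fin' local_on_rep[OF fin']] orbit_self) auto
  then show "app (rep (stdp g S)) v z = app 0 v z"
    unfolding eq by (simp add: local_onD[OF local_on_stdp[OF fin' local_on_rep[OF fin']] orbit_self] app_simps)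
qed

lemma stdp_identity:
  assumes "infinite (UNIV :: 'k set)" and "finite (twist_group \<alpha> \<beta>)"
  shows "2 * card (twist_group \<alpha> \<beta>) \<in> PI_degrees (qmat_algebra \<alpha> \<beta>)"
proof -
  let ?F = "stdp free_var {..<2 * card (twist_group \<alpha> \<beta>)} :: 'k nc_poly"
  have "poly_identity (qmat_algebra \<alpha> \<beta>) ?F"
    unfolding qmat_algebra_def poly_identity_Q fs.free_eval_stdp fs.free_eval_var
    using assms by (intro allI stdp_in_ideal) simp_all
  moreover have "nc_degree ?F = 2 * card (twist_group \<alpha> \<beta>)" by (simp add: stdp_nc_poly)
  ultimately show ?thesis
    unfolding PI_degrees_def using stdp_nc_poly(2,3)[of "{..<2 * card (twist_group \<alpha> \<beta>)}", where 'k = 'k]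
    by (intro CollectI exI[of _ ?F]) simp
qed

end

section \<open>The lower bound\<close>

context qmat
begin

text \<open>On this orbit the shift factors \<open>p x\<close> and \<open>q x\<close> are nonzero,
  and from \<open>x = y = 1\<close> the group acts freely.\<close>

abbreviation base where "base \<equiv> orbit (1, 1, 1, 1)"

lemma mem_base: "w \<in> base \<longleftrightarrow> (\<exists>i j. w = (\<alpha> ^ i * \<beta> ^ j, 1 / (\<alpha> ^ j * \<beta> ^ i), 1, 1))"
  by (auto simp: orbit_def twist_group_def image_iff)

lemma card_base: "card base = card (twist_group \<alpha> \<beta>)"
  unfolding orbit_def using nz by (auto simp: twist_group_def inj_on_def intro!: card_image)

text \<open>Lagrange interpolation. \<open>X11\<close> and the quantum determinant \<open>?D\<close>
  have eigenvalues \<open>x\<close> and \<open>x y\<close>, and as \<open>x\<close> is nonzero on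
  the orbit these tell its points apart. Each \<open>u \<noteq> z\<close> contributes a factor that
  vanishes at \<open>u\<close> and is 1 at \<open>z\<close>.\<close>

lemma separate:
  assumes fin: "finite base" and z: "z \<in> base"
  shows "\<exists>m. \<forall>v. \<forall>w\<in>base. app (rep m) v w = (if w = z then v w else 0)"
proof -
  let ?D = "free_var X11 * free_var X22 - free_const (inverse \<alpha>) * free_var X12 * free_var X21"
  have coord1: "app (rep (free_var X11)) v w = fst w * v w" for v and w :: "'k \<times> 'k \<times> 'k \<times> 'k"
    by (cases w) (simp add: rep_simps app_qop)
  have coord2: "app (rep ?D) v w = fst w * fst (snd w) * v w" for v and w :: "'k \<times> 'k \<times> 'k \<times> 'k"
    using nz by (cases w) (simp add: rep_simps app_simps app_qop scal.rep_eq field_simps)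
  have "\<exists>m \<phi>. \<phi> z = 1 \<and> (\<forall>u\<in>A. \<phi> u = 0) \<and> (\<forall>v. \<forall>w\<in>base. app (rep m) v w = \<phi> w * v w)"
    if "A \<subseteq> base - {z}" for A
    using finite_subset[OF that finite_Diff[OF fin]] that
  proof (induction A rule: finite_induct)
    case empty
    show ?case by (intro exI[of _ 1] exI[of _ "\<lambda>_. 1"]) (simp add: rep_simps app_simps)
  next
    case (insert u A)
    then obtain m \<phi> where "\<phi> z = 1 \<and> (\<forall>u\<in>A. \<phi> u = 0) \<and> (\<forall>v. \<forall>w\<in>base. app (rep m) v w = \<phi> w * v w)"
      by auto
    then have m: "\<phi> z = 1" "\<And>u. u \<in> A \<Longrightarrow> \<phi> u = 0" "\<And>v w. w \<in> base \<Longrightarrow> app (rep m) v w = \<phi> w * v w"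
      by blast+
    have "\<exists>c \<psi>. \<psi> z \<noteq> \<psi> u \<and> (\<forall>v w. app (rep c) v w = \<psi> w * v w)"
    proof (cases "fst z = fst u")
      case False
      then show ?thesis using coord1 by (intro exI[of _ "free_var X11"] exI[of _ fst]) simp
    next
      case True
      from insert.prems have "u \<in> base" "u \<noteq> z" by auto
      with z True nz have "fst z * fst (snd z) \<noteq> fst u * fst (snd u)" by (auto simp: mem_base)
      then show ?thesis using coord2 by (intro exI[of _ ?D] exI[of _ "\<lambda>w. fst w * fst (snd w)"]) simp
    qed
    then obtain c \<psi> where c: "\<psi> z \<noteq> \<psi> u" "\<And>v w. app (rep c) v w = \<psi> w * v w" by blast
    define \<phi>' where "\<phi>' w = (\<psi> w - \<psi> u) / (\<psi> z - \<psi> u) * \<phi> w" for w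
    have "app (rep (free_const (inverse (\<psi> z - \<psi> u)) * (c - free_const (\<psi> u)) * m)) v w = \<phi>' w * v w"
      if "w \<in> base" for v w
      using m(3)[OF that] c by (simp add: rep_simps app_simps scal.rep_eq \<phi>'_def divide_inverse left_diff_distrib right_diff_distrib mult_ac)
    moreover have "\<phi>' z = 1" "\<forall>u\<in>insert u A. \<phi>' u = 0" using m c(1) by (simp_all add: \<phi>'_def)
    ultimately show ?case by blast
  qed
  from this[of "base - {z}"] obtain m \<phi> where "\<phi> z = 1" "\<forall>u\<in>base - {z}. \<phi> u = 0"
    "\<forall>v. \<forall>w\<in>base. app (rep m) v w = \<phi> w * v w" by auto
  then show ?thesis by (intro exI[of _ m]) auto
qed

lemma connect:
  assumes ru: "root_of_unity \<alpha>" "root_of_unity \<beta>" and zw: "z \<in> base" "w \<in> base"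
  shows "\<exists>m. \<forall>v. app (rep m) v z = v w"
proof -
  have step: "\<exists>m'. \<forall>v. app (rep m') v u = v (\<alpha> * x, y / \<beta>, 1, 1)"
      "\<exists>m'. \<forall>v. app (rep m') v u = v (\<beta> * x, y / \<alpha>, 1, 1)"
    if m: "\<And>v. app (rep m) v u = v (x, y, 1, 1)" and x: "x \<noteq> 0" for m u x y
  proof -
    \<comment> \<open>A factor on the right prolongs the path at its end point
      \<open>(x, y)\<close>, where the generator contributes the scalar \<open>x\<close>.\<close>
    have "app (rep (free_const (inverse x) * m * free_var X12)) v u = v (\<alpha> * x, y / \<beta>, 1, 1)"
      "app (rep (free_const (inverse x) * m * free_var X21)) v u = v (\<beta> * x, y / \<alpha>, 1, 1)" for v
      using x by (simp_all add: rep_simps app_simps scal.rep_eq m app_qop)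
    then show "\<exists>m'. \<forall>v. app (rep m') v u = v (\<alpha> * x, y / \<beta>, 1, 1)"
      "\<exists>m'. \<forall>v. app (rep m') v u = v (\<beta> * x, y / \<alpha>, 1, 1)" by blast+
  qed
  have reach: "\<exists>m. \<forall>v. app (rep m) v (x, y, 1, 1) = v (\<alpha> ^ i * \<beta> ^ j * x, y / (\<alpha> ^ j * \<beta> ^ i), 1, 1)"
    if x: "x \<noteq> 0" for x y i j
  proof (induction i)
    case 0
    show ?case
    proof (induction j)
      case 0
      show ?case by (intro exI[of _ 1]) (simp add: rep_simps app_simps)
    next
      case (Suc j)
      then obtain m where "\<And>v. app (rep m) v (x, y, 1, 1) = v (\<beta> ^ j * x, y / \<alpha> ^ j, 1, 1)" by auto
      from step(2)[OF this] x nz show ?case by (simp add: mult_ac)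
    qed
  next
    case (Suc i)
    then obtain m where "\<And>v. app (rep m) v (x, y, 1, 1) = v (\<alpha> ^ i * \<beta> ^ j * x, y / (\<alpha> ^ j * \<beta> ^ i), 1, 1)" by auto
    from step(1)[OF this] x nz show ?case by (simp add: mult_ac)
  qed
  obtain k l where kl: "k > 0" "l > 0" "\<alpha> ^ k = 1" "\<beta> ^ l = 1"
    using ru by (auto simp: root_of_unity_def)
  \<comment> \<open>Powers to the \<open>n\<close> are inverses, so \<open>n\<close> replaces the
    exponent -1 when going back from \<open>z\<close> to \<open>(1, 1)\<close>.\<close>
  define n where "n = k * l - 1"
  have n: "\<alpha> ^ Suc n = 1" "\<beta> ^ Suc n = 1"
  proof -
    have "Suc n = k * l" using kl by (simp add: n_def)
    moreover have "\<alpha> ^ (k * l) = 1" "\<beta> ^ (l * k) = 1" using kl by (simp_all add: power_mult)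
    ultimately show "\<alpha> ^ Suc n = 1" "\<beta> ^ Suc n = 1" by (simp_all add: mult.commute)
  qed
  obtain a b where z: "z = (\<alpha> ^ a * \<beta> ^ b, 1 / (\<alpha> ^ b * \<beta> ^ a), 1, 1)" using zw(1) by (auto simp: mem_base)
  obtain i j where w: "w = (\<alpha> ^ i * \<beta> ^ j, 1 / (\<alpha> ^ j * \<beta> ^ i), 1, 1)" using zw(2) by (auto simp: mem_base)
  have cancel: "\<alpha> ^ (i + n * a) * \<alpha> ^ a = \<alpha> ^ i" "\<beta> ^ (i + n * a) * \<beta> ^ a = \<beta> ^ i" for i a
  proof -
    have "i + n * a + a = i + Suc n * a" by simp
    then show "\<alpha> ^ (i + n * a) * \<alpha> ^ a = \<alpha> ^ i" "\<beta> ^ (i + n * a) * \<beta> ^ a = \<beta> ^ i"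
      by (simp_all only: power_add[symmetric]) (simp_all only: power_add power_mult n power_one mult_1_right)
  qed
  have "\<alpha> ^ (i + n * a) * \<beta> ^ (j + n * b) * (\<alpha> ^ a * \<beta> ^ b)
      = (\<alpha> ^ (i + n * a) * \<alpha> ^ a) * (\<beta> ^ (j + n * b) * \<beta> ^ b)" by (simp only: mult_ac)
  moreover have "1 / (\<alpha> ^ b * \<beta> ^ a) / (\<alpha> ^ (j + n * b) * \<beta> ^ (i + n * a))
      = 1 / ((\<alpha> ^ (j + n * b) * \<alpha> ^ b) * (\<beta> ^ (i + n * a) * \<beta> ^ a))" by (simp add: mult_ac)
  moreover have "\<alpha> ^ a * \<beta> ^ b \<noteq> 0" using nz by simp
  ultimately show ?thesis
    using reach[of "\<alpha> ^ a * \<beta> ^ b" "1 / (\<alpha> ^ b * \<beta> ^ a)" "i + n * a" "j + n * b"]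
    unfolding z w cancel by simp
qed

lemma matrix_units:
  assumes fin: "finite base" and ru: "root_of_unity \<alpha>" "root_of_unity \<beta>"
    and zw: "z \<in> base" "w \<in> base"
  shows "\<exists>m. \<forall>v. \<forall>u\<in>base. app (rep m) v u = (if u = z then v w else 0)"
proof -
  obtain m where m: "\<And>v u. u \<in> base \<Longrightarrow> app (rep m) v u = (if u = z then v u else 0)"
    using separate[OF fin zw(1)] by auto
  obtain m' where m': "\<And>v. app (rep m') v z = v w" using connect[OF ru zw] by auto
  have "app (rep (m * m')) v u = (if u = z then v w else 0)" if "u \<in> base" for v u
    using that by (simp add: rep_simps app_simps m m')
  then show ?thesis by blast
qed

text \<open>
  The staircase: the units \<open>E\<^sub>0\<^sub>0, E\<^sub>0\<^sub>1, E\<^sub>1\<^sub>1, E\<^sub>1\<^sub>2, \<dots>\<close> have a nonzero product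
  in their natural order only. The \<open>m\<close>-th one has row \<open>m div 2\<close> and column \<open>(m + 1) div 2\<close>.
\<close>

lemma identity_degree_ge:
  assumes fin: "finite base" and ru: "root_of_unity \<alpha>" "root_of_unity \<beta>"
    and monic: "nc_monic F" and multi: "nc_multilinear F" and id: "poly_identity (qmat_algebra \<alpha> \<beta>) F"
  shows "2 * card base \<le> nc_degree F"
proof (rule ccontr)
  define N d where "N = card base" and "d = nc_degree F"
  assume "\<not> ?thesis"
  then have d: "d < 2 * N" by (simp add: N_def d_def)
  obtain e where "bij_betw e {0..<N} base" using ex_bij_betw_nat_finite[OF fin] by (auto simp: N_def)
  then have e_mem: "\<And>i. i < N \<Longrightarrow> e i \<in> base" and e_inj: "\<And>i j. i < N \<Longrightarrow> j < N \<Longrightarrow> e i = e j \<longleftrightarrow> i = j"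
    by (auto simp: bij_betw_def inj_on_def)
  obtain w0 where w0: "w0 \<in> Poly_Mapping.keys F" "length (letters w0) = d" "Poly_Mapping.lookup F w0 = 1"
    using monic by (auto simp: nc_monic_def d_def)
  obtain V where V: "\<And>w. w \<in> Poly_Mapping.keys F \<Longrightarrow> distinct (letters w) \<and> set (letters w) = V"
    using multi by (auto simp: nc_multilinear_def)
  define ls where "ls = letters w0"
  have ls: "distinct ls" "set ls = V" "length ls = d" using V[OF w0(1)] w0(2) by (simp_all add: ls_def)
  define pos where "pos = inv_into {..<d} ((!) ls)"
  have nth: "bij_betw ((!) ls) {..<d} V" using ls by (auto intro: bij_betw_nth)
  have pos_nth: "\<And>m. m < d \<Longrightarrow> pos (ls ! m) = m" and pos_lt: "\<And>x. x \<in> V \<Longrightarrow> pos x < d"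
    and nth_pos: "\<And>x. x \<in> V \<Longrightarrow> ls ! pos x = x"
    using nth bij_betw_inv_into[OF nth]
    by (auto simp: pos_def bij_betw_def inv_into_f_f f_inv_into_f)
  have "\<exists>g. \<forall>v. \<forall>u\<in>base. m < d \<longrightarrow> app (rep g) v u = (if u = e (m div 2) then v (e ((m + 1) div 2)) else 0)" for m
  proof (cases "m < d")
    case True
    \<comment> \<open>The assumed bound on the degree enters here: the columns run up to
      \<open>d div 2\<close>, which must be a valid index.\<close>
    with d have "m div 2 < N" "(m + 1) div 2 < N" by auto
    from matrix_units[OF fin ru e_mem[OF this(1)] e_mem[OF this(2)]] show ?thesis by auto
  qed auto
  then obtain g where g: "\<And>m v u. u \<in> base \<Longrightarrow> m < d \<Longrightarrow>
      app (rep (g m)) v u = (if u = e (m div 2) then v (e ((m + 1) div 2)) else 0)"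
    by metis
  define E where "E m = rep (g m)" for m
  \<comment> \<open>Applying a product to this indicator and evaluating at \<open>e 0\<close> reads
    off its entry in row 0 and column \<open>d div 2\<close>, the last column of the
    staircase.\<close>
  define v where "v = (\<lambda>u. if u = e (d div 2) then 1 else (0 :: 'k))"
  have E: "app (E m) f (e a) = (if a = m div 2 then f (e ((m + 1) div 2)) else 0)" if "m < d" "a < N" for m a f
    using that d by (simp add: E_def g e_mem e_inj)
  \<comment> \<open>A unit with row \<open>a\<close> has number \<open>2 * a\<close> or
    \<open>2 * a + 1\<close>, and its column is the row required next. The lower bound
    \<open>2 * a\<close> carries sortedness through the induction.\<close>
  have sorted: "sorted ms \<and> (\<forall>m\<in>set ms. 2 * a \<le> m)"
    if "app (prod_list (map E ms)) v (e a) \<noteq> 0" "set ms \<subseteq> {..<d}" "a < N" for ms a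
    using that
  proof (induction ms arbitrary: a)
    case (Cons m ms)
    have m: "m < d" "(m + 1) div 2 < N" using Cons.prems d by auto
    from Cons.prems have a: "a = m div 2" and ne: "app (prod_list (map E ms)) v (e ((m + 1) div 2)) \<noteq> 0"
      using E[OF m(1) Cons.prems(3)] by (auto simp: app_simps split: if_splits)
    from Cons.IH[OF ne _ m(2)] Cons.prems have "sorted ms" "\<forall>k\<in>set ms. 2 * ((m + 1) div 2) \<le> k" by auto
    then show ?case using a by fastforce
  qed simp
  have staircase: "app (prod_list (map E [k..<d])) v (e (k div 2)) = 1" if "k \<le> d" for k
    using that
  proof (induction k rule: inc_induct)
    case base
    then show ?case by (simp add: v_def app_simps)
  next
    case (step k)
    then have "[k..<d] = k # [Suc k..<d]" "k div 2 < N" using d by (auto simp: upt_conv_Cons)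
    then show ?case using step by (simp add: app_simps E)
  qed
  have N: "0 < N" using d by simp
  \<comment> \<open>The staircase is assigned in the order of the letters of \<open>w0\<close>, a
    word with coefficient 1. By multilinearity every other word rearranges the same letters and
    hence contributes 0.\<close>
  define h where "h x = g (pos x)" for x
  have val: "app (prod_list (map (\<lambda>x. rep (h x)) (letters w))) v (e 0) = (if w = w0 then 1 else 0)"
    if "w \<in> Poly_Mapping.keys F" for w
  proof -
    define ms where "ms = map pos (letters w)"
    have w: "distinct (letters w)" "set (letters w) = V" using V[OF that] by auto
    have map_eq: "map (\<lambda>x. rep (h x)) (letters w) = map E ms" by (simp add: ms_def E_def h_def)
    have letters: "letters w = map ((!) ls) ms"
      unfolding ms_def map_map comp_def by (rule map_idI[symmetric]) (simp add: w(2) nth_pos)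
    have set_ms: "set ms = {..<d}"
      using w(2) bij_betw_inv_into[OF nth] by (auto simp: ms_def pos_def bij_betw_def)
    have dist: "distinct ms"
      using w bij_betw_inv_into[OF nth] by (auto simp: ms_def pos_def bij_betw_def distinct_map)
    show ?thesis
    proof (cases "w = w0")
      case True
      have "ms = [0..<d]"
        by (rule nth_equalityI) (auto simp: ms_def True ls(3) pos_nth simp flip: ls_def)
      with staircase[of 0] True show ?thesis unfolding map_eq by simp
    next
      case False
      have "app (prod_list (map E ms)) v (e 0) = 0"
      proof (rule ccontr)
        assume "app (prod_list (map E ms)) v (e 0) \<noteq> 0"
        from sorted[OF this _ N] set_ms have "sorted ms" by auto
        then have "ms = [0..<d]"
          using dist set_ms by (intro sorted_distinct_set_unique) (auto simp: atLeast0LessThan)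
        then have "letters w = ls" using letters map_nth[of ls] by (simp add: ls(3))
        with False show False by (cases w; cases w0) (simp add: ls_def)
      qed
      with False show ?thesis by (simp add: map_eq)
    qed
  qed
  have "fs.free_eval h F \<in> I"
    using id unfolding qmat_algebra_def poly_identity_Q by blast
  then have "0 = app (rep (fs.free_eval h F)) v (e 0)" by (simp add: rep_ideal app_simps)
  also have "rep (fs.free_eval h F) = ls.free_eval (\<lambda>i. rep (h i)) F"
    by (simp add: rep_def ls.free_eval_subst)
  also have "app \<dots> v (e 0) = (\<Sum>w\<in>Poly_Mapping.keys F. Poly_Mapping.lookup F w * (if w = w0 then 1 else 0))"
    unfolding ls.free_eval_def app_sum by (intro sum.cong refl) (simp add: app_simps scal.rep_eq val)
  also have "\<dots> = 1" using w0 by (simp add: if_distrib[of "\<lambda>x. _ * x"] cong: if_cong)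
  finally show False by simp
qed

lemma PI_deg_qmat:
  assumes inf: "infinite (UNIV :: 'k set)" and fin: "finite (twist_group \<alpha> \<beta>)"
    and ru: "root_of_unity \<alpha>" "root_of_unity \<beta>"
  shows "PI_deg (qmat_algebra \<alpha> \<beta>) = of_nat (card (twist_group \<alpha> \<beta>))"
proof -
  let ?N = "card (twist_group \<alpha> \<beta>)"
  have fin': "finite base" using fin by (auto simp: orbit_def)
  have "(LEAST d. d \<in> PI_degrees (qmat_algebra \<alpha> \<beta>)) = 2 * ?N"
  proof (rule Least_equality)
    show "2 * ?N \<in> PI_degrees (qmat_algebra \<alpha> \<beta>)" by (rule stdp_identity[OF inf fin])
    show "2 * ?N \<le> d" if "d \<in> PI_degrees (qmat_algebra \<alpha> \<beta>)" for d
      using that identity_degree_ge[OF fin' ru] by (auto simp: PI_degrees_def card_base)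
  qed
  moreover have "PI_degrees (qmat_algebra \<alpha> \<beta>) \<noteq> {}" using stdp_identity[OF inf fin] by blast
  ultimately show ?thesis by (simp add: PI_deg_def)
qed

end

theorem theorem4p3:
  fixes \<alpha> \<beta> :: "'k::alg_closed_field"
  assumes "\<alpha> \<noteq> 0" and "\<beta> \<noteq> 0"
    and "root_of_unity \<alpha>" and "root_of_unity \<beta>"
    and "\<alpha> \<noteq> \<beta>" and "\<alpha> \<noteq> inverse \<beta>"
  shows "PI_deg (qmat_algebra \<alpha> \<beta>) =
    (if unit_ord \<beta> dvd unit_ord (\<alpha> * \<beta>) * unit_ord (\<alpha> * inverse \<beta>)
     then of_nat (unit_ord (\<alpha> * \<beta>) * unit_ord (\<alpha> * inverse \<beta>))
     else of_nat (2 * unit_ord (\<alpha> * \<beta>) * unit_ord (\<alpha> * inverse \<beta>)))"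
proof -
  interpret qmat \<alpha> \<beta> by unfold_locales (fact assms)+
  show ?thesis
    unfolding PI_deg_qmat[OF infinite_alg_closed card_twist_group(1)[OF assms(1-4)] assms(3,4)]
    by (simp add: card_twist_group(2)[OF assms(1-4)])
qed

end
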